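(* Let $f,g\in\mathrm{Diff}(\mathbb{C},0)$ have periods $k,l\in\mathbb{N}^*$ respectively, i.e. $f^k=\mathrm{id}$ and $g^l=\mathrm{id}$ on a neighborhood of $0$. Then, for $h$ belonging to some $G_\delta$-dense set $\mathcal{H}\subset\mathrm{Diff}(\mathbb{C},0)$ (for the analytic topology), the group generated by $f$ and $h^{-1}\circ g\circ h$ in the group of germs $\mathrm{Diff}(\mathbb{C},0)$ is isomorphic to the group with presentation $\langle a,b\,;\,a^k=b^l=\mathrm{id}\rangle$.
   Context: $\mathrm{Diff}(\mathbb{C},0)$ is the group of germs of holomorphic diffeomorphisms of $\mathbb{C}$ fixing $0$. The period of $f$ is its order as a germ. Analytic topology: for $r>0$ and $h$ holomorphic near $0$, $\|h\|_r=\sup_{B(r)}|h|$ if $h$ extends holomorphically to the open disc $B(r)$ of radius $r$, and $+\infty$ otherwise; a basis of open sets is given by $\{g:\|g-f\|_r<\varepsilon\}$, $f\in\mathrm{Diff}(\mathbb{C},0)$, $r,\varepsilon>0$. A $G_\delta$-dense set is a countable intersection of open dense sets. *)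

theory Defs
  imports "HOL-Analysis.Analysis" "HOL-Algebra.Generated_Groups"
begin

definition germ_eq :: "(complex \<Rightarrow> complex) \<Rightarrow> (complex \<Rightarrow> complex) \<Rightarrow> bool" where
  "germ_eq f g \<longleftrightarrow> (\<forall>\<^sub>F z in nhds 0. f z = g z)"

text \<open>Representatives of elements of Diff(C,0): holomorphic near 0, fixing 0,
  with non-vanishing derivative at 0 (i.e. germs of local biholomorphisms).\<close>
definition Diff0 :: "(complex \<Rightarrow> complex) set" where
  "Diff0 = {f. (\<exists>r>0. f holomorphic_on ball 0 r) \<and> f 0 = 0 \<and> deriv f 0 \<noteq> 0}"

definition has_period :: "(complex \<Rightarrow> complex) \<Rightarrow> nat \<Rightarrow> bool" where
  "has_period f k \<longleftrightarrow> k > 0 \<and> germ_eq (f ^^ k) id \<and>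
     (\<forall>j. 0 < j \<and> j < k \<longrightarrow> \<not> germ_eq (f ^^ j) id)"

definition germ_norm :: "real \<Rightarrow> (complex \<Rightarrow> complex) \<Rightarrow> ereal" where
  "germ_norm r h =
     (if \<exists>H. H holomorphic_on ball 0 r \<and> germ_eq H h
      then (let H = (SOME H. H holomorphic_on ball 0 r \<and> germ_eq H h)
            in (SUP z\<in>ball 0 r. ereal (cmod (H z))))
      else \<infinity>)"

definition analytic_basis :: "(complex \<Rightarrow> complex) set set" where
  "analytic_basis =
     { {g \<in> Diff0. germ_norm r (\<lambda>z. g z - f z) < ereal \<epsilon>} | f r \<epsilon>. f \<in> Diff0 \<and> r > 0 \<and> \<epsilon> > 0}"

definition analytic_topology :: "(complex \<Rightarrow> complex) topology" where
  "analytic_topology = topology_generated_by analytic_basis"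

definition Gdelta_dense :: "'a topology \<Rightarrow> 'a set \<Rightarrow> bool" where
  "Gdelta_dense X S \<longleftrightarrow>
     (\<exists>\<U>. countable \<U> \<and> (\<forall>U\<in>\<U>. openin X U \<and> X closure_of U = topspace X) \<and>
          S = topspace X \<inter> \<Inter>\<U>)"

definition germ_class :: "(complex \<Rightarrow> complex) \<Rightarrow> (complex \<Rightarrow> complex) set" where
  "germ_class f = {g \<in> Diff0. germ_eq f g}"

definition germ_rep :: "(complex \<Rightarrow> complex) set \<Rightarrow> (complex \<Rightarrow> complex)" where
  "germ_rep X = (SOME f. f \<in> X)"

definition Diff_group :: "(complex \<Rightarrow> complex) set monoid" where
  "Diff_group = \<lparr> carrier = germ_class ` Diff0,
                  mult = (\<lambda>X Y. germ_class (germ_rep X \<circ> germ_rep Y)),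
                  one = germ_class id \<rparr>"

datatype gen = GA | GB

text \<open>A letter is a generator together with a flag: True means the inverse letter.\<close>
type_synonym letter = "gen \<times> bool"

inductive pres_eq :: "nat \<Rightarrow> nat \<Rightarrow> letter list \<Rightarrow> letter list \<Rightarrow> bool" for k l where
  refl: "pres_eq k l w w"
| sym: "pres_eq k l u v \<Longrightarrow> pres_eq k l v u"
| trans: "pres_eq k l u v \<Longrightarrow> pres_eq k l v w \<Longrightarrow> pres_eq k l u w"
| cancel: "pres_eq k l (u @ [(x, e), (x, \<not> e)] @ v) (u @ v)"
| relA: "pres_eq k l (u @ replicate k (GA, False) @ v) (u @ v)"
| relB: "pres_eq k l (u @ replicate l (GB, False) @ v) (u @ v)"

definition pres_class :: "nat \<Rightarrow> nat \<Rightarrow> letter list \<Rightarrow> letter list set" where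
  "pres_class k l w = {v. pres_eq k l w v}"

definition presented_group :: "nat \<Rightarrow> nat \<Rightarrow> letter list set monoid" where
  "presented_group k l = \<lparr> carrier = range (pres_class k l),
     mult = (\<lambda>X Y. pres_class k l ((SOME x. x \<in> X) @ (SOME y. y \<in> Y))),
     one = pres_class k l [] \<rparr>"

end

theory Submission
  imports Defs "HOL-Complex_Analysis.Complex_Analysis"
begin

text \<open>The set of all \<open>h\<close> for which a fixed nonempty normal form \<open>w\<close> of the free product of the two
  cyclic groups is nontrivial at \<open>(f, h\<^sup>-\<^sup>1 g h)\<close> is open, because the Taylor coefficients of \<open>w\<close> are
  continuous in \<open>h\<close>. Its density is shown by induction on the length of \<open>w\<close>. After cyclic reduction
  and rotation, \<open>w = u f^n\<close> where \<open>u\<close> starts with a power of \<open>h\<^sup>-\<^sup>1 g h\<close>. By induction, \<open>h\<close> can be chosen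
  such that the values \<open>v\<^sub>0, \<dots>, v\<^sub>m\<close> of the suffixes of \<open>u\<close> are pairwise distinct. If \<open>w\<close> were
  trivial near \<open>h\<close>, then \<open>u\<close> would be constant along \<open>h + t z^n\<close> for every \<open>n \<ge> 2\<close>. The derivative of
  \<open>u\<close> at \<open>t = 0\<close> has the form \<open>\<Sum>K\<^sub>i v\<^sub>i^n\<close> with power series \<open>K\<^sub>i\<close> that do not depend on \<open>n\<close> and
  \<open>K\<^sub>0 \<noteq> 0\<close>, so a Vandermonde argument in the integral domain of power series gives a contradiction.\<close>

unbundle no vec_syntax
unbundle fps_syntax

section \<open>Normal forms in the presented group\<close>

definition period_of :: "nat \<Rightarrow> nat \<Rightarrow> gen \<Rightarrow> nat" where
  "period_of k l x = (case x of GA \<Rightarrow> k | GB \<Rightarrow> l)"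

definition gen_val :: "'a \<Rightarrow> 'a \<Rightarrow> gen \<Rightarrow> 'a" where
  "gen_val a b x = (case x of GA \<Rightarrow> a | GB \<Rightarrow> b)"

text \<open>A block \<open>(x, n)\<close> stands for the power \<open>x^n\<close>.\<close>

definition normal_form :: "nat \<Rightarrow> nat \<Rightarrow> (gen \<times> nat) list \<Rightarrow> bool" where
  "normal_form k l w \<longleftrightarrow>
     (\<forall>(x, n)\<in>set w. 0 < n \<and> n < period_of k l x) \<and> distinct_adj (map fst w)"

definition expand :: "(gen \<times> nat) list \<Rightarrow> letter list" where
  "expand w = concat (map (\<lambda>(x, n). replicate n (x, False)) w)"

lemma expand_simps [simp]:
  "expand [] = []" "expand ((x, n) # w) = replicate n (x, False) @ expand w"
  by (simp_all add: expand_def)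

lemma normal_form_Nil [simp]: "normal_form k l []"
  by (simp add: normal_form_def)

lemma normal_form_Cons:
  "normal_form k l ((x, n) # w) \<longleftrightarrow>
     0 < n \<and> n < period_of k l x \<and> (w = [] \<or> fst (hd w) \<noteq> x) \<and> normal_form k l w"
  by (cases w) (auto simp: normal_form_def distinct_adj_Cons)

lemma normal_form_append:
  "normal_form k l (u @ v) \<longleftrightarrow> normal_form k l u \<and> normal_form k l v \<and>
     (u = [] \<or> v = [] \<or> fst (last u) \<noteq> fst (hd v))"
  by (auto simp: normal_form_def distinct_adj_append_iff last_map hd_map)

lemma pres_eq_cong: "pres_eq k l u v \<Longrightarrow> pres_eq k l (x @ u @ y) (x @ v @ y)"
proof (induction rule: pres_eq.induct)
  case (cancel u z e v)
  show ?case using pres_eq.cancel[of k l "x @ u" z e "v @ y"] by simp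
next
  case (relA u v)
  show ?case using pres_eq.relA[of k l "x @ u" "v @ y"] by simp
next
  case (relB u v)
  show ?case using pres_eq.relB[of k l "x @ u" "v @ y"] by simp
qed (blast intro: pres_eq.intros)+

lemma pres_eq_rel:
  "pres_eq k l (u @ replicate (period_of k l x) (x, False) @ v) (u @ v)"
  by (cases x) (simp_all add: period_of_def pres_eq.relA pres_eq.relB)

text \<open>Inserting the relator \<open>x^p\<close> right after the inverse letter and cancelling
  one pair turns it into \<open>p - 1\<close> positive letters; this is how inverse letters are
  eliminated.\<close>

lemma pres_eq_inv_letter:
  assumes "0 < period_of k l x"
  shows "pres_eq k l ((x, True) # w) (replicate (period_of k l x - 1) (x, False) @ w)"
proof -
  let ?p = "period_of k l x"
  have "replicate ?p (x, False) = (x, False) # replicate (?p - 1) (x, False)"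
    using assms by (metis Suc_diff_1 replicate_Suc)
  then have "pres_eq k l ([(x, True)] @ (x, False) # replicate (?p - 1) (x, False) @ w) ((x, True) # w)"
    using pres_eq_rel[of k l "[(x, True)]" x w] by simp
  moreover have "pres_eq k l ([(x, True)] @ (x, False) # replicate (?p - 1) (x, False) @ w)
                   (replicate (?p - 1) (x, False) @ w)"
    using pres_eq.cancel[of k l "[]" x True "replicate (?p - 1) (x, False) @ w"] by simp
  ultimately show ?thesis
    by (blast intro: pres_eq.sym pres_eq.trans)
qed

text \<open>A new letter affects only the front of the word: it opens a block or raises the leading
  exponent by one. When that exponent reaches the period, the block disappears and leaves a tail
  that is again a normal form.\<close>

lemma normal_form_Cons_letter:
  assumes "normal_form k l n" and pos: "0 < period_of k l x"
  shows "\<exists>n'. normal_form k l n' \<and> pres_eq k l ((x, False) # expand n) (expand n')"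
proof (cases "n \<noteq> [] \<and> fst (hd n) = x")
  case True
  then obtain i m where n: "n = (x, i) # m" by (metis list.collapse prod.collapse)
  then have i: "0 < i" "i < period_of k l x" "m = [] \<or> fst (hd m) \<noteq> x" "normal_form k l m"
    using assms by (auto simp: normal_form_Cons)
  show ?thesis
  proof (cases "Suc i = period_of k l x")
    case True
    then have "(x, False) # expand n = replicate (period_of k l x) (x, False) @ expand m"
      by (simp add: n flip: True)
    then show ?thesis
      using i pres_eq_rel[of k l "[]" x "expand m"] by (intro exI[of _ m]) simp
  next
    case False
    then show ?thesis
      using i n by (intro exI[of _ "(x, Suc i) # m"]) (simp add: normal_form_Cons pres_eq.refl)
  qed
next
  case other: False
  show ?thesis
  \<comment> \<open>With period 1 the letter is itself a relator and a block of exponent 1 would not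
    be admissible, so \<open>n\<close> is kept.\<close>
  proof (cases "period_of k l x = 1")
    case True
    then show ?thesis
      using assms pres_eq_rel[of k l "[]" x "expand n"] by (intro exI[of _ n]) simp
  next
    case False
    then show ?thesis
      using assms other
      by (intro exI[of _ "(x, 1) # n"]) (auto simp: normal_form_Cons pres_eq.refl)
  qed
qed

lemma ex_normal_form:
  assumes "0 < k" "0 < l"
  shows "\<exists>n. normal_form k l n \<and> pres_eq k l w (expand n)"
proof (induction w)
  case Nil
  show ?case by (intro exI[of _ "[]"]) (simp add: pres_eq.refl)
next
  case (Cons c w)
  obtain x e where c: "c = (x, e)" by (cases c)
  have pos: "0 < period_of k l y" for y using assms by (cases y) (auto simp: period_of_def)
  obtain n where n: "normal_form k l n" "pres_eq k l w (expand n)" using Cons by blast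
  \<comment> \<open>Stated for \<open>j\<close> copies of the letter: \<open>j = 1\<close> serves a
    positive letter, and the period minus one serves an inverse letter.\<close>
  have power: "\<exists>n'. normal_form k l n' \<and> pres_eq k l (replicate j (x, False) @ w) (expand n')" for j
  proof (induction j)
    case 0
    show ?case using n by auto
  next
    case (Suc j)
    then obtain m where m: "normal_form k l m" "pres_eq k l (replicate j (x, False) @ w) (expand m)"
      by blast
    obtain m' where "normal_form k l m'" "pres_eq k l ((x, False) # expand m) (expand m')"
      using normal_form_Cons_letter[OF m(1) pos] by blast
    then show ?case
      using pres_eq_cong[OF m(2), of "[(x, False)]" "[]"]
      by (auto intro: pres_eq.trans)
  qed
  show ?case
  proof (cases e)
    case True
    then show ?thesis
      using power[of "period_of k l x - 1"] pres_eq_inv_letter[OF pos, of x w] c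
      by (auto intro: pres_eq.trans)
  next
    case False
    then show ?thesis using power[of 1] c by simp
  qed
qed

text \<open>Reverse the word and flip every flag. Such inverses reduce equality of two words to
  triviality of a single one.\<close>

lemma ex_inverse_word: "\<exists>v. pres_eq k l (v @ w) [] \<and> pres_eq k l (w @ v) []"
proof (induction w)
  case Nil
  show ?case by (intro exI[of _ "[]"]) (simp add: pres_eq.refl)
next
  case (Cons c w)
  obtain x e where c: "c = (x, e)" by (cases c)
  obtain v where v: "pres_eq k l (v @ w) []" "pres_eq k l (w @ v) []" using Cons by blast
  have "pres_eq k l ((v @ [(x, \<not> e)]) @ c # w) []"
    using pres_eq.cancel[of k l v x "\<not> e" w] v(1) c by (auto intro: pres_eq.trans)
  moreover have "pres_eq k l ((c # w) @ v @ [(x, \<not> e)]) []"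
    using pres_eq_cong[OF v(2), of "[c]" "[(x, \<not> e)]"] pres_eq.cancel[of k l "[]" x e "[]"] c
    by (auto intro: pres_eq.trans)
  ultimately show ?case by blast
qed

section \<open>Evaluation of words in an arbitrary group\<close>

context group
begin

definition letter_val :: "'a \<Rightarrow> 'a \<Rightarrow> letter \<Rightarrow> 'a" where
  "letter_val a b c = (if snd c then inv (gen_val a b (fst c)) else gen_val a b (fst c))"

definition word_val :: "'a \<Rightarrow> 'a \<Rightarrow> letter list \<Rightarrow> 'a" where
  "word_val a b w = foldr (\<lambda>c y. letter_val a b c \<otimes> y) w \<one>"

definition block_val :: "'a \<Rightarrow> 'a \<Rightarrow> (gen \<times> nat) list \<Rightarrow> 'a" where
  "block_val a b w = foldr (\<lambda>c y. gen_val a b (fst c) [^] snd c \<otimes> y) w \<one>"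

lemma word_val_simps [simp]:
  "word_val a b [] = \<one>"
  "word_val a b (c # w) = letter_val a b c \<otimes> word_val a b w"
  by (simp_all add: word_val_def)

lemma block_val_simps [simp]:
  "block_val a b [] = \<one>"
  "block_val a b (c # w) = gen_val a b (fst c) [^] snd c \<otimes> block_val a b w"
  by (simp_all add: block_val_def)

lemma gen_val_closed [simp]:
  "a \<in> carrier G \<Longrightarrow> b \<in> carrier G \<Longrightarrow> gen_val a b x \<in> carrier G"
  by (cases x) (simp_all add: gen_val_def)

lemma letter_val_closed [simp]:
  "a \<in> carrier G \<Longrightarrow> b \<in> carrier G \<Longrightarrow> letter_val a b c \<in> carrier G"
  by (simp add: letter_val_def)

lemma word_val_closed [simp]:
  "a \<in> carrier G \<Longrightarrow> b \<in> carrier G \<Longrightarrow> word_val a b w \<in> carrier G"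
  by (induction w) auto

lemma block_val_closed [simp]:
  "a \<in> carrier G \<Longrightarrow> b \<in> carrier G \<Longrightarrow> block_val a b w \<in> carrier G"
  by (induction w) auto

lemma word_val_append:
  "a \<in> carrier G \<Longrightarrow> b \<in> carrier G \<Longrightarrow>
     word_val a b (u @ v) = word_val a b u \<otimes> word_val a b v"
  by (induction u) (auto simp: m_assoc)

lemma block_val_append:
  "a \<in> carrier G \<Longrightarrow> b \<in> carrier G \<Longrightarrow>
     block_val a b (u @ v) = block_val a b u \<otimes> block_val a b v"
  by (induction u) (auto simp: m_assoc)

lemma word_val_replicate:
  assumes "a \<in> carrier G" "b \<in> carrier G"
  shows "word_val a b (replicate n (x, False)) = gen_val a b x [^] n"
proof (induction n)
  case (Suc n)
  then show ?case
    using nat_pow_Suc2[of "gen_val a b x" n] assms by (simp add: letter_val_def)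
qed simp

lemma word_val_expand:
  "a \<in> carrier G \<Longrightarrow> b \<in> carrier G \<Longrightarrow> word_val a b (expand n) = block_val a b n"
  by (induction n) (auto simp: word_val_append word_val_replicate)

text \<open>Soundness of the presentation: a cancelling pair and both relators evaluate to the
  identity, so the value depends only on the class of the word.\<close>

lemma word_val_pres_eq:
  assumes "pres_eq k l u v" "a \<in> carrier G" "b \<in> carrier G" "a [^] k = \<one>" "b [^] l = \<one>"
  shows "word_val a b u = word_val a b v"
  using assms
proof (induction rule: pres_eq.induct)
  case (cancel u x e v)
  then have "word_val a b [(x, e), (x, \<not> e)] = \<one>"
    by (simp add: letter_val_def)
  then show ?case
    using cancel by (simp only: word_val_append word_val_closed l_one)
qed (simp_all add: word_val_append word_val_replicate gen_val_def)

lemma generate_eq_range_word_val: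
  assumes "a \<in> carrier G" "b \<in> carrier G"
  shows "generate G {a, b} = range (word_val a b)"
proof (intro equalityI subsetI)
  fix y assume "y \<in> generate G {a, b}"
  then show "y \<in> range (word_val a b)"
  proof induction
    case one
    show ?case by (metis rangeI word_val_simps(1))
  next
    case (incl h)
    then have "h = word_val a b [(if h = a then GA else GB, False)]"
      using assms by (auto simp: letter_val_def gen_val_def)
    then show ?case by (metis rangeI)
  next
    case (inv h)
    then have "inv h = word_val a b [(if h = a then GA else GB, True)]"
      using assms by (auto simp: letter_val_def gen_val_def)
    then show ?case by (metis rangeI)
  next
    case (eng h1 h2)
    then obtain u v where "h1 = word_val a b u" "h2 = word_val a b v" by auto
    then have "h1 \<otimes> h2 = word_val a b (u @ v)"
      by (simp only: word_val_append[OF assms])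
    then show ?case by (metis rangeI)
  qed
next
  fix y assume "y \<in> range (word_val a b)"
  then obtain w where "y = word_val a b w" by blast
  moreover have "word_val a b w \<in> generate G {a, b}"
  proof (induction w)
    case (Cons c w)
    have "letter_val a b c \<in> generate G {a, b}"
      by (cases "fst c")
         (auto simp: letter_val_def gen_val_def intro: generate.incl generate.inv)
    with Cons show ?case by (simp add: generate.eng)
  qed (simp add: generate.one)
  ultimately show "y \<in> generate G {a, b}" by simp
qed

text \<open>Modulo the relations each word is a normal form. If nonempty normal forms have
  nontrivial values, a word of value 1 must reduce to the empty word, so evaluation is faithful on
  classes; its image is the generated subgroup.\<close>

theorem generate_iso_presented_group:
  assumes a: "a \<in> carrier G" and b: "b \<in> carrier G"
    and "0 < k" "0 < l" and ak: "a [^] k = \<one>" and bl: "b [^] l = \<one>"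
    and nontrivial: "\<And>n. normal_form k l n \<Longrightarrow> n \<noteq> [] \<Longrightarrow> block_val a b n \<noteq> \<one>"
  shows "G\<lparr>carrier := generate G {a, b}\<rparr> \<cong> presented_group k l"
proof -
  let ?ev = "word_val a b"
  note sound = word_val_pres_eq[OF _ a b ak bl]
  have trivial: "pres_eq k l w []" if "?ev w = \<one>" for w
  proof -
    obtain n where n: "normal_form k l n" "pres_eq k l w (expand n)"
      using ex_normal_form \<open>0 < k\<close> \<open>0 < l\<close> by blast
    then have "block_val a b n = \<one>" using that sound word_val_expand[OF a b] by metis
    then have "n = []" using nontrivial n by blast
    then show ?thesis using n by simp
  qed
  have complete: "pres_eq k l u v \<longleftrightarrow> ?ev u = ?ev v" for u v
  proof
    assume eq: "?ev u = ?ev v"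
    obtain v' where v': "pres_eq k l (v' @ v) []" "pres_eq k l (v @ v') []"
      using ex_inverse_word by blast
    have "?ev (u @ v') = \<one>"
      using sound[OF v'(2)] eq by (simp add: word_val_append a b)
    then have "pres_eq k l (u @ v' @ v) v"
      using pres_eq_cong[OF trivial, of "u @ v'" "[]" v] by simp
    moreover have "pres_eq k l (u @ v' @ v) u"
      using pres_eq_cong[OF v'(1), of u "[]"] by simp
    ultimately show "pres_eq k l u v" by (blast intro: pres_eq.sym pres_eq.trans)
  qed (rule sound)
  have cls: "pres_class k l w = {v. ?ev v = ?ev w}" for w
    by (auto simp: pres_class_def complete)
  \<comment> \<open>The inverse of evaluation: \<open>\<psi> y\<close> is the whole fibre over
    \<open>y\<close>, which by \<open>cls\<close> is exactly one class. Any word that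
    \<open>SOME\<close> picks from a fibre has the same value, as recorded in
    \<open>some\<close>.\<close>
  define \<psi> where "\<psi> y = {w. ?ev w = y}" for y
  have some: "?ev (SOME x. x \<in> \<psi> (?ev w)) = ?ev w" for w
    using someI[of "\<lambda>x. x \<in> \<psi> (?ev w)" w] by (simp add: \<psi>_def)
  have "\<psi> \<in> iso (G\<lparr>carrier := generate G {a, b}\<rparr>) (presented_group k l)"
    unfolding generate_eq_range_word_val[OF a b]
  proof (intro isoI homI)
    fix x y assume "x \<in> carrier (G\<lparr>carrier := range ?ev\<rparr>)" "y \<in> carrier (G\<lparr>carrier := range ?ev\<rparr>)"
    then obtain u v where "x = ?ev u" "y = ?ev v" by auto
    then show "\<psi> (x \<otimes>\<^bsub>G\<lparr>carrier := range ?ev\<rparr>\<^esub> y) = \<psi> x \<otimes>\<^bsub>presented_group k l\<^esub> \<psi> y"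
      by (simp add: presented_group_def cls word_val_append a b some) (simp add: \<psi>_def)
  next
    show "bij_betw \<psi> (carrier (G\<lparr>carrier := range ?ev\<rparr>)) (carrier (presented_group k l))"
      unfolding bij_betw_def
    proof
      show "inj_on \<psi> (carrier (G\<lparr>carrier := range ?ev\<rparr>))"
        by (rule inj_onI) (auto simp: \<psi>_def dest!: equalityD1)
      have "pres_class k l = (\<lambda>w. \<psi> (?ev w))"
        by (rule ext) (simp add: cls \<psi>_def)
      then show "\<psi> ` carrier (G\<lparr>carrier := range ?ev\<rparr>) = carrier (presented_group k l)"
        by (simp add: presented_group_def image_image)
    qed
  qed (auto simp: presented_group_def cls \<psi>_def)
  then show ?thesis unfolding is_iso_def by blast
qed

end

section \<open>Formal power series depending on a parameter\<close>

text \<open>Linear combinations of the relations with exponents from \<open>N\<close> on replace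
  \<open>u i ^ n\<close> by \<open>u i ^ N * poly q (u i)\<close> for any polynomial
  \<open>q\<close>. A \<open>q\<close> vanishing at all nodes except \<open>u j\<close> isolates
  \<open>K j\<close>, and in an integral domain the remaining nonzero factors cancel.\<close>

lemma vandermonde_independent:
  fixes u K :: "'i \<Rightarrow> 'a::idom"
  assumes "finite S" "inj_on u S" and nz: "\<And>i. i \<in> S \<Longrightarrow> u i \<noteq> 0"
    and zero: "\<And>n. n \<ge> N \<Longrightarrow> (\<Sum>i\<in>S. K i * u i ^ n) = 0"
    and "j \<in> S"
  shows "K j = 0"
proof -
  define p where "p = (\<Prod>i\<in>S - {j}. [:- u i, 1:])"
  have "(\<Sum>i\<in>S. K i * u i ^ N * poly q (u i)) = 0" for q
  proof -
    have "(\<Sum>i\<in>S. K i * u i ^ N * poly q (u i)) =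
            (\<Sum>i\<in>S. \<Sum>m\<le>degree q. coeff q m * (K i * u i ^ (N + m)))"
      by (simp add: poly_altdef sum_distrib_left power_add mult_ac)
    also have "\<dots> = (\<Sum>m\<le>degree q. coeff q m * (\<Sum>i\<in>S. K i * u i ^ (N + m)))"
      by (subst sum.swap) (simp add: sum_distrib_left)
    also have "\<dots> = 0" by (simp add: zero)
    finally show ?thesis .
  qed
  from this[of p] have "(\<Sum>i\<in>S. K i * u i ^ N * poly p (u i)) = 0" .
  moreover have "poly p (u i) = 0" if "i \<in> S - {j}" for i
    using that \<open>finite S\<close> by (auto simp: p_def poly_prod intro!: prod_zero)
  ultimately have "K j * u j ^ N * poly p (u j) = 0"
    using \<open>finite S\<close> \<open>j \<in> S\<close> by (simp add: sum.remove)
  moreover have "poly p (u j) \<noteq> 0"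
    using assms by (auto simp: p_def poly_prod inj_on_def)
  ultimately show ?thesis using nz[OF \<open>j \<in> S\<close>] by simp
qed

text \<open>Instantiated with continuity on a space of series and with differentiability in a complex
  parameter.\<close>

locale coeff_regular =
  fixes P :: "('t \<Rightarrow> complex) \<Rightarrow> bool" and T :: "'t set"
  assumes P_const: "P (\<lambda>_. c)"
    and P_add: "P \<phi> \<Longrightarrow> P \<psi> \<Longrightarrow> P (\<lambda>t. \<phi> t + \<psi> t)"
    and P_mult: "P \<phi> \<Longrightarrow> P \<psi> \<Longrightarrow> P (\<lambda>t. \<phi> t * \<psi> t)"
    and P_inverse: "P \<phi> \<Longrightarrow> (\<And>t. t \<in> T \<Longrightarrow> \<phi> t \<noteq> 0) \<Longrightarrow> P (\<lambda>t. inverse (\<phi> t))"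
begin

definition regular :: "('t \<Rightarrow> complex fps) \<Rightarrow> bool" where
  "regular A \<longleftrightarrow> (\<forall>n. P (\<lambda>t. A t $ n))"

lemma P_sum: "(\<And>i. i \<in> S \<Longrightarrow> P (\<phi> i)) \<Longrightarrow> P (\<lambda>t. \<Sum>i\<in>S. \<phi> i t)"
  by (induction S rule: infinite_finite_induct) (auto intro: P_const P_add)

lemma P_power: "P \<phi> \<Longrightarrow> P (\<lambda>t. \<phi> t ^ n)"
  by (induction n) (auto intro: P_const P_mult)

lemma P_diff: "P \<phi> \<Longrightarrow> P \<psi> \<Longrightarrow> P (\<lambda>t. \<phi> t - \<psi> t)"
  using P_add[of \<phi> "\<lambda>t. (-1) * \<psi> t"] P_mult[of "\<lambda>_. -1" \<psi>] P_const[of "-1"] by simp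

lemma regular_const: "regular (\<lambda>_. A)"
  by (simp add: regular_def P_const)

lemma regular_mult: "regular A \<Longrightarrow> regular B \<Longrightarrow> regular (\<lambda>t. A t * B t)"
  unfolding regular_def fps_mult_nth by (intro allI P_sum P_mult) auto

lemma regular_power: "regular A \<Longrightarrow> regular (\<lambda>t. A t ^ n)"
  by (induction n) (auto intro: regular_const regular_mult)

lemma regular_compose: "regular A \<Longrightarrow> regular B \<Longrightarrow> regular (\<lambda>t. A t oo B t)"
  using regular_power[of B]
  unfolding regular_def fps_compose_nth by (intro allI P_sum P_mult) auto

text \<open>\<open>compinv\<close> is a recursion whose only division is by a power of
  \<open>A t $ 1\<close> and whose \<open>n\<close>-th value uses lower ones only; hence strong
  induction on \<open>n\<close>.\<close>

lemma regular_inv: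
  assumes A: "regular A" and nz: "\<And>t. t \<in> T \<Longrightarrow> A t $ 1 \<noteq> 0"
  shows "regular (\<lambda>t. fps_inv (A t))"
  unfolding regular_def
proof
  fix n
  have "P (\<lambda>t. compinv (A t) n)"
  proof (induction n rule: less_induct)
    case (less n)
    show ?case
    proof (cases n)
      case 0
      then show ?thesis by (simp add: P_const)
    next
      case (Suc m)
      have "P (\<lambda>t. inverse ((A t $ 1) ^ Suc m))"
        using A nz unfolding regular_def by (intro P_inverse P_power) auto
      moreover have "P (\<lambda>t. fps_X $ Suc m - (\<Sum>i=0..m. compinv (A t) i * (A t ^ i) $ Suc m))"
        using regular_power[OF A] less Suc unfolding regular_def
        by (intro P_diff P_const P_sum P_mult) auto
      ultimately show ?thesis
        unfolding Suc compinv.simps divide_inverse by (intro P_mult)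
    qed
  qed
  then show "P (\<lambda>t. fps_inv (A t) $ n)" by (simp add: fps_inv_def)
qed

end

section \<open>Derivative at 0 of a one-parameter family of series, taken coefficientwise\<close>

definition coeff_deriv :: "(complex \<Rightarrow> complex fps) \<Rightarrow> complex fps \<Rightarrow> bool" where
  "coeff_deriv A A' \<longleftrightarrow> (\<forall>n. ((\<lambda>t. A t $ n) has_field_derivative A' $ n) (at 0))"

interpretation differentiable: coeff_regular "\<lambda>\<phi>. \<phi> field_differentiable at (0::complex)" UNIV
  by unfold_locales
     (auto intro: field_differentiable_add field_differentiable_mult field_differentiable_inverse)

lemma coeff_deriv_unique: "coeff_deriv A A' \<Longrightarrow> coeff_deriv A A'' \<Longrightarrow> A' = A''"
  unfolding coeff_deriv_def fps_eq_iff by (meson DERIV_unique)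

lemma differentiable_imp_coeff_deriv:
  assumes "differentiable.regular A"
  obtains A' where "coeff_deriv A A'"
proof
  show "coeff_deriv A (Abs_fps (\<lambda>n. deriv (\<lambda>t. A t $ n) 0))"
    using assms by (simp add: differentiable.regular_def coeff_deriv_def field_differentiable_derivI)
qed

lemma coeff_deriv_imp_differentiable: "coeff_deriv A A' \<Longrightarrow> differentiable.regular A"
  unfolding differentiable.regular_def coeff_deriv_def
  using field_differentiable_def by blast

lemma coeff_deriv_const: "coeff_deriv (\<lambda>_. A) 0"
  by (simp add: coeff_deriv_def)

lemma coeff_deriv_eventually_const:
  "coeff_deriv A A' \<Longrightarrow> \<forall>\<^sub>F t in nhds 0. A t = A 0 \<Longrightarrow> A' = 0"
proof (rule coeff_deriv_unique)
  assume "\<forall>\<^sub>F t in nhds 0. A t = A 0"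
  then have "\<forall>\<^sub>F t in nhds 0. A t $ n = A 0 $ n" for n
    by (rule eventually_mono) simp
  then have "((\<lambda>t. A t $ n) has_field_derivative 0) (at 0) \<longleftrightarrow>
             ((\<lambda>t. A 0 $ n) has_field_derivative 0) (at (0::complex))" for n
    by (intro DERIV_cong_ev) auto
  then show "coeff_deriv A 0" by (simp add: coeff_deriv_def)
qed

lemma coeff_deriv_mult:
  assumes "coeff_deriv A A'" "coeff_deriv B B'"
  shows "coeff_deriv (\<lambda>t. A t * B t) (A' * B 0 + A 0 * B')"
  unfolding coeff_deriv_def fps_mult_nth fps_add_nth sum.distrib[symmetric]
proof (intro allI DERIV_sum)
  fix n i
  show "((\<lambda>t. A t $ i * B t $ (n - i)) has_field_derivative
          (A' $ i * B 0 $ (n - i) + A 0 $ i * B' $ (n - i))) (at 0)"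
    using assms unfolding coeff_deriv_def
    by (auto intro!: derivative_eq_intros)
qed

lemma coeff_deriv_power:
  assumes "coeff_deriv A A'"
  shows "coeff_deriv (\<lambda>t. A t ^ n) (of_nat n * A 0 ^ (n - 1) * A')"
proof (induction n)
  case (Suc n)
  have "A' * A 0 ^ n + A 0 * (of_nat n * A 0 ^ (n - 1) * A') = of_nat (Suc n) * A 0 ^ n * A'"
    by (cases n) (auto simp: algebra_simps)
  with coeff_deriv_mult[OF assms Suc] show ?case by simp
qed (use coeff_deriv_const[of 1] in simp)

text \<open>As \<open>B\<close> has no constant term, \<open>B ^ i\<close> contributes nothing below
  degree \<open>i\<close>. So the sums for all coefficients up to degree \<open>n\<close> can share
  one range, and the order of summation can be exchanged.\<close>

lemma fps_compose_mult_nth: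
  fixes A B C :: "complex fps"
  assumes "B $ 0 = 0"
  shows "((A oo B) * C) $ n = (\<Sum>i=0..n. A $ i * (B ^ i * C) $ n)"
proof -
  have "(A oo B) $ m = (\<Sum>i=0..n. A $ i * (B ^ i) $ m)" if "m \<le> n" for m
    unfolding fps_compose_nth using that assms
    by (intro sum.mono_neutral_left) (auto simp: startsby_zero_power_prefix)
  then have "((A oo B) * C) $ n = (\<Sum>m=0..n. \<Sum>i=0..n. A $ i * ((B ^ i) $ m * C $ (n - m)))"
    by (simp add: fps_mult_nth sum_distrib_right mult.assoc)
  then show ?thesis
    by (subst (asm) sum.swap) (simp add: fps_mult_nth sum_distrib_left)
qed

text \<open>Chain rule. Each coefficient of a composition is a finite sum and is differentiated
  termwise; the terms with the derivative of \<open>B t ^ i\<close> reassemble to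
  \<open>(fps_deriv (A 0) oo B 0) * B'\<close> after shifting the index by one.\<close>

lemma coeff_deriv_compose:
  assumes A: "coeff_deriv A A'" and B: "coeff_deriv B B'" and B0: "\<And>t. B t $ 0 = 0"
  shows "coeff_deriv (\<lambda>t. A t oo B t) ((A' oo B 0) + (fps_deriv (A 0) oo B 0) * B')"
  unfolding coeff_deriv_def
proof
  fix n
  have "((\<lambda>t. B t $ 0) has_field_derivative B' $ 0) (at 0)"
    using B by (simp add: coeff_deriv_def)
  then have B'0: "B' $ 0 = 0" by (simp add: B0 DERIV_unique)
  have "((\<lambda>t. \<Sum>i=0..n. A t $ i * (B t ^ i) $ n) has_field_derivative
          (\<Sum>i=0..n. A' $ i * (B 0 ^ i) $ n + A 0 $ i * (of_nat i * B 0 ^ (i - 1) * B') $ n)) (at 0)"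
    using A coeff_deriv_power[OF B] unfolding coeff_deriv_def
    by (intro DERIV_sum) (auto intro!: derivative_eq_intros)
  moreover have "(\<Sum>i=0..n. A 0 $ i * (of_nat i * B 0 ^ (i - 1) * B') $ n) =
                   ((fps_deriv (A 0) oo B 0) * B') $ n"
  proof -
    have *: "(of_nat i * B 0 ^ (i - 1) * B') $ n = of_nat i * (B 0 ^ (i - 1) * B') $ n" for i
      by (simp add: mult.assoc fps_of_nat flip: fps_const_mult_left)
    \<comment> \<open>\<open>B 0 ^ n\<close> starts in degree \<open>n\<close> and \<open>B'\<close>
      in degree 1, so the top term vanishes; without it the shifted index range ends exactly at
      \<open>n\<close>.\<close>
    have last: "(B 0 ^ n * B') $ n = 0"
    proof -
      have "(B 0 ^ n) $ i * B' $ (n - i) = 0" if "i \<le> n" for i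
        using that B0[of 0] B'0 by (cases "i = n") (auto simp: startsby_zero_power_prefix)
      then show ?thesis unfolding fps_mult_nth by (intro sum.neutral) auto
    qed
    have "((fps_deriv (A 0) oo B 0) * B') $ n =
            (\<Sum>i=0..n. of_nat (Suc i) * A 0 $ Suc i * (B 0 ^ i * B') $ n)"
      by (simp add: fps_compose_mult_nth[OF B0])
    also have "\<dots> = (\<Sum>i<n. of_nat (Suc i) * A 0 $ Suc i * (B 0 ^ i * B') $ n)"
      using last by (simp add: atLeast0AtMost lessThan_Suc_atMost[symmetric])
    also have "\<dots> = (\<Sum>i=0..n. A 0 $ i * (of_nat i * B 0 ^ (i - 1) * B') $ n)"
      unfolding * atLeast0AtMost lessThan_Suc_atMost[symmetric] sum.lessThan_Suc_shift
      by (simp add: mult_ac)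
    finally show ?thesis ..
  qed
  ultimately show "((\<lambda>t. (A t oo B t) $ n) has_field_derivative
       ((A' oo B 0) + (fps_deriv (A 0) oo B 0) * B') $ n) (at 0)"
    by (simp add: fps_compose_nth sum.distrib)
qed

lemma fps_inv_nth_0 [simp]: "fps_inv A $ 0 = 0"
  by (simp add: fps_inv_def)

lemma fps_inv_nth_1: "A $ 1 \<noteq> 0 \<Longrightarrow> fps_inv A $ 1 = inverse (A $ 1)"
  by (simp add: fps_inv_def divide_simps)

text \<open>\<open>regular_inv\<close> supplies differentiability. The value then follows by
  differentiating \<open>A t oo fps_inv (A t) = fps_X\<close> with the chain rule and solving, since
  \<open>fps_deriv (A 0) oo C\<close> has nonzero constant term.\<close>

lemma coeff_deriv_inv:
  assumes A: "coeff_deriv A A'" and A0: "\<And>t. A t $ 0 = 0" and A1: "\<And>t. A t $ 1 \<noteq> 0"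
  defines "C \<equiv> fps_inv (A 0)"
  shows "coeff_deriv (\<lambda>t. fps_inv (A t)) (- (A' oo C) * inverse (fps_deriv (A 0) oo C))"
proof -
  obtain C' where C': "coeff_deriv (\<lambda>t. fps_inv (A t)) C'"
    using differentiable_imp_coeff_deriv differentiable.regular_inv coeff_deriv_imp_differentiable[OF A] A1
    by metis
  have "coeff_deriv (\<lambda>t. A t oo fps_inv (A t)) ((A' oo C) + (fps_deriv (A 0) oo C) * C')"
    unfolding C_def by (rule coeff_deriv_compose[OF A C']) simp
  moreover have "(\<lambda>t. A t oo fps_inv (A t)) = (\<lambda>t. fps_X)"
    using A0 A1 by (simp add: fps_inv_right)
  ultimately have "(A' oo C) + (fps_deriv (A 0) oo C) * C' = 0"
    using coeff_deriv_unique coeff_deriv_const by metis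
  then have *: "(fps_deriv (A 0) oo C) * C' = - (A' oo C)" 
    by (simp add: eq_neg_iff_add_eq_0 add.commute)
  have "inverse (fps_deriv (A 0) oo C) * (fps_deriv (A 0) oo C) = 1"
    using A1[of 0] by (intro inverse_mult_eq_1) simp
  then have "C' = inverse (fps_deriv (A 0) oo C) * ((fps_deriv (A 0) oo C) * C')"
    by (simp flip: mult.assoc)
  then have "C' = - (A' oo C) * inverse (fps_deriv (A 0) oo C)"
    unfolding * by (simp add: mult.commute)
  with C' show ?thesis by simp
qed

section \<open>Variation of a word in its conjugating series\<close>

definition diffeo_fps :: "complex fps set" where
  "diffeo_fps = {A. A $ 0 = 0 \<and> A $ 1 \<noteq> 0}"

text \<open>\<open>F n\<close> and \<open>G n\<close> stand for the powers \<open>f^n\<close> and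
  \<open>g^n\<close>, and a \<open>GB\<close> block acts as the conjugate \<open>h^-1 g^n h\<close>.
  Conjugating block by block makes each occurrence of \<open>H\<close> explicit for
  differentiation.\<close>

fun fps_word :: "(nat \<Rightarrow> complex fps) \<Rightarrow> (nat \<Rightarrow> complex fps) \<Rightarrow> complex fps \<Rightarrow>
    (gen \<times> nat) list \<Rightarrow> complex fps" where
  "fps_word F G H [] = fps_X"
| "fps_word F G H ((GA, n) # w) = F n oo fps_word F G H w"
| "fps_word F G H ((GB, n) # w) = fps_inv H oo (G n oo (H oo fps_word F G H w))"

lemma fps_X_diffeo [simp]: "fps_X \<in> diffeo_fps"
  by (simp add: diffeo_fps_def)

lemma fps_compose_diffeo: "A \<in> diffeo_fps \<Longrightarrow> B \<in> diffeo_fps \<Longrightarrow> A oo B \<in> diffeo_fps"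
  by (simp add: diffeo_fps_def fps_compose_nth)

lemma fps_inv_diffeo: "A \<in> diffeo_fps \<Longrightarrow> fps_inv A \<in> diffeo_fps"
  by (simp add: diffeo_fps_def fps_inv_nth_1[simplified])

lemma (in coeff_regular) regular_fps_word:
  assumes "regular H" "\<And>t. t \<in> T \<Longrightarrow> H t $ 1 \<noteq> 0"
  shows "regular (\<lambda>t. fps_word F G (H t) w)"
proof (induction w)
  case (Cons c w)
  then show ?case using assms
    by (cases c; cases "fst c") (auto intro!: regular_compose regular_const regular_inv)
qed (simp add: regular_const)

locale block_series =
  fixes F G :: "nat \<Rightarrow> complex fps"
  assumes F: "F n \<in> diffeo_fps" and G: "G n \<in> diffeo_fps"
begin

lemma fps_word_diffeo:
  assumes "H \<in> diffeo_fps"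
  shows "fps_word F G H w \<in> diffeo_fps"
proof (induction w)
  case (Cons c w)
  then show ?case using assms F G
    by (cases c; cases "fst c") (auto intro!: fps_compose_diffeo fps_inv_diffeo)
qed simp

text \<open>The point is that \<open>K\<close> does not depend on the exponent \<open>n\<close> of the perturbation.\<close>

lemma coeff_deriv_fps_word:
  assumes H: "H \<in> diffeo_fps"
  shows "\<exists>K. (\<forall>n\<ge>2. coeff_deriv (\<lambda>t. fps_word F G (H + fps_const t * fps_X ^ n) w)
                (\<Sum>i\<le>length w. K i * fps_word F G H (drop i w) ^ n)) \<and>
             (w \<noteq> [] \<longrightarrow> fst (hd w) = GB \<longrightarrow> K 0 \<noteq> 0)"
proof (induction w)
  case Nil
  show ?case by (intro exI[of _ "\<lambda>_. 0"]) (simp add: coeff_deriv_const)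
next
  case (Cons c w)
  obtain x j where c: "c = (x, j)" by (cases c)
  obtain K where K: "\<And>n. n \<ge> 2 \<Longrightarrow>
      coeff_deriv (\<lambda>t. fps_word F G (H + fps_const t * fps_X ^ n) w)
        (\<Sum>i\<le>length w. K i * fps_word F G H (drop i w) ^ n)"
    using Cons by blast
  define v where "v = fps_word F G H w"
  define H' where "H' n t = H + fps_const t * fps_X ^ n" for n t
  \<comment> \<open>The exponent is at least 2, so the perturbation leaves the coefficients of
    degree 0 and 1 unchanged and every \<open>t\<close> is allowed.\<close>
  have H'_diffeo: "H' n t \<in> diffeo_fps" if "n \<ge> 2" for n t
    using H that by (simp add: diffeo_fps_def H'_def)
  note W_diffeo = fps_word_diffeo[OF H'_diffeo]
  have W0: "fps_word F G (H' n t) w $ 0 = 0" if "n \<ge> 2" for n t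
    using W_diffeo[OF that] by (simp add: diffeo_fps_def)
  have [simp]: "H' n 0 = H" for n by (simp add: H'_def)
  define D where "D n = (\<Sum>i\<le>length w. K i * fps_word F G H (drop i w) ^ n)" for n
  have D: "coeff_deriv (\<lambda>t. fps_word F G (H' n t) w) (D n)" if "n \<ge> 2" for n
    using K[OF that] by (simp add: H'_def D_def)
  have v0: "v $ 0 = 0" using fps_word_diffeo[OF H] by (simp add: v_def diffeo_fps_def)
  show ?case
  proof (cases x)
    case GA
    \<comment> \<open>\<open>F j\<close> does not move with \<open>t\<close>, so the chain rule only
      multiplies the old coefficients by \<open>M\<close>, and the value of the longer word gets
      coefficient 0.\<close>
    define M where "M = fps_deriv (F j) oo v"
    have "coeff_deriv (\<lambda>t. fps_word F G (H' n t) (c # w)) (M * D n)" if "n \<ge> 2" for n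
      using coeff_deriv_compose[OF coeff_deriv_const D[OF that] W0[OF that], of "F j"]
      by (simp add: c GA M_def v_def)
    then show ?thesis
      unfolding H'_def
      by (intro exI[of _ "\<lambda>i. case i of 0 \<Rightarrow> 0 | Suc i \<Rightarrow> M * K i"])
         (simp add: c GA D_def sum.atMost_Suc_shift sum_distrib_left mult.assoc del: sum.atMost_Suc)
  next
    case GB
    define C where "C = fps_inv H"
    define y where "y = G j oo (H oo v)"
    define I where "I = inverse (fps_deriv H oo (C oo y))"
    define M where "M = (fps_deriv C oo y) * (fps_deriv (G j) oo (H oo v))"
    define N where "N = fps_deriv H oo v"
    have y0: "y $ 0 = 0" and C0: "C $ 0 = 0" using G by (auto simp: y_def C_def diffeo_fps_def)
    have H0: "H' n t $ 0 = 0" and H1: "H' n t $ 1 \<noteq> 0" if "n \<ge> 2" for n t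
      using H'_diffeo[OF that] by (auto simp: diffeo_fps_def)
    have Hd: "fps_deriv H $ 0 \<noteq> 0" using H by (simp add: diffeo_fps_def)
    \<comment> \<open>Three sources of variation: the outer \<open>fps_inv (H' n t)\<close> yields
      the \<open>n\<close>-th power of the value \<open>C oo y\<close> of the whole word, the inner
      \<open>H' n t\<close> yields that of the tail value \<open>v\<close>, and the tail itself
      contributes \<open>D n\<close>.\<close>
    have deriv: "coeff_deriv (\<lambda>t. fps_word F G (H' n t) (c # w))
            (- I * (C oo y) ^ n + M * (v ^ n + N * D n))" if n: "n \<ge> 2" for n
    proof -
      have dH: "coeff_deriv (H' n) (fps_X ^ n)"
        unfolding coeff_deriv_def H'_def
        by (auto intro!: derivative_eq_intros)
      have dHw: "coeff_deriv (\<lambda>t. H' n t oo fps_word F G (H' n t) w) (v ^ n + N * D n)"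
        using coeff_deriv_compose[OF dH D[OF n] W0[OF n]]
        by (simp add: fps_X_power_compose v0 N_def flip: v_def)
      have dGHw: "coeff_deriv (\<lambda>t. G j oo (H' n t oo fps_word F G (H' n t) w))
             ((fps_deriv (G j) oo (H oo v)) * (v ^ n + N * D n))"
        using coeff_deriv_compose[OF coeff_deriv_const dHw, of "G j"] H0[OF n]
        by (simp add: v_def)
      have dC: "coeff_deriv (\<lambda>t. fps_inv (H' n t)) (- (C ^ n) * inverse (fps_deriv H oo C))"
        using coeff_deriv_inv[OF dH H0[OF n] H1[OF n]]
        by (simp add: C_def fps_X_power_compose)
      have "(- (C ^ n) * inverse (fps_deriv H oo C)) oo y = - I * (C oo y) ^ n"
        using Hd y0 C0
        by (simp add: fps_compose_mult_distrib fps_compose_uminus fps_compose_power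
              fps_inverse_compose fps_compose_assoc I_def mult.commute)
      then show ?thesis
        using coeff_deriv_compose[OF dC dGHw] G
        by (simp add: c GB M_def C_def y_def v_def diffeo_fps_def mult.assoc)
    qed
    have "I $ 0 \<noteq> 0" using Hd by (simp add: I_def)
    then have "I \<noteq> 0" by auto
    have v_alt: "C oo y = fps_word F G H (c # w)"
      by (simp add: C_def y_def v_def c GB)
    have sum: "M * (v ^ n + N * D n) =
        (\<Sum>i\<le>length w. (M * N * K i + (if i = 0 then M else 0)) * fps_word F G H (drop i w) ^ n)" for n
    proof -
      have "(if i = 0 then M else 0) * fps_word F G H (drop i w) ^ n = (if i = 0 then M * v ^ n else 0)" for i
        by (simp add: v_def)
      then have "(\<Sum>i\<le>length w. (if i = 0 then M else 0) * fps_word F G H (drop i w) ^ n) = M * v ^ n"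
        by (simp only: sum.delta finite_atMost atMost_iff le0 if_True)
      then show ?thesis
        by (simp only: D_def distrib_left distrib_right sum.distrib sum_distrib_left mult.assoc add.commute)
    qed
    \<comment> \<open>\<open>- I\<close> belongs to the whole word and is nonzero because
      \<open>fps_deriv H\<close> has nonzero constant term. The extra \<open>M\<close> goes to the
      tail \<open>w\<close>, which has index 1 in the longer word.\<close>
    show ?thesis
      using deriv \<open>I \<noteq> 0\<close> unfolding H'_def sum v_alt
      by (intro exI[of _ "\<lambda>i. case i of 0 \<Rightarrow> - I | Suc i \<Rightarrow> M * N * K i + (if i = 0 then M else 0)"])
         (simp add: sum.atMost_Suc_shift del: sum.atMost_Suc fps_word.simps)
  qed
qed

text \<open>Local constancy for every \<open>n\<close> would make the derivative sums vanish for all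
  \<open>n \<ge> 2\<close>. The suffix values are distinct and nonzero, so
  \<open>vandermonde_independent\<close> would force \<open>K 0 = 0\<close>, which a leading
  \<open>GB\<close> block excludes.\<close>

lemma fps_word_nonconstant:
  assumes H: "H \<in> diffeo_fps" and w: "w \<noteq> []" "fst (hd w) = GB"
    and inj: "inj_on (\<lambda>i. fps_word F G H (drop i w)) {..length w}"
  shows "\<exists>n\<ge>2. \<not> (\<forall>\<^sub>F t in nhds 0. fps_word F G (H + fps_const t * fps_X ^ n) w = fps_word F G H w)"
proof (rule ccontr)
  assume "\<not> ?thesis"
  then have const: "\<And>n. n \<ge> 2 \<Longrightarrow>
      \<forall>\<^sub>F t in nhds 0. fps_word F G (H + fps_const t * fps_X ^ n) w = fps_word F G H w"
    by blast
  obtain K where K: "\<And>n. n \<ge> 2 \<Longrightarrow>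
      coeff_deriv (\<lambda>t. fps_word F G (H + fps_const t * fps_X ^ n) w)
        (\<Sum>i\<le>length w. K i * fps_word F G H (drop i w) ^ n)" and "K 0 \<noteq> 0"
    using coeff_deriv_fps_word[OF H, of w] w by blast
  have "(\<Sum>i\<le>length w. K i * fps_word F G H (drop i w) ^ n) = 0" if "n \<ge> 2" for n
    using coeff_deriv_eventually_const[OF K[OF that]] const[OF that] by simp
  moreover have "fps_word F G H (drop i w) \<noteq> 0" for i
    using fps_word_diffeo[OF H, of "drop i w"] by (auto simp: diffeo_fps_def)
  ultimately have "K 0 = 0"
    by (intro vandermonde_independent[OF _ inj, of 2 K 0]) auto
  with \<open>K 0 \<noteq> 0\<close> show False by simp
qed

end

section \<open>Germs and their Taylor series\<close>

definition fps_group :: "complex fps monoid" where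
  "fps_group = \<lparr>carrier = diffeo_fps, mult = (oo), one = fps_X\<rparr>"

lemma fps_group_simps [simp]:
  "carrier fps_group = diffeo_fps" "A \<otimes>\<^bsub>fps_group\<^esub> B = A oo B" "\<one>\<^bsub>fps_group\<^esub> = fps_X"
  by (simp_all add: fps_group_def)

interpretation fps_group: group fps_group
proof (rule groupI)
  fix A B assume "A \<in> carrier fps_group" "B \<in> carrier fps_group"
  then show "A \<otimes>\<^bsub>fps_group\<^esub> B \<in> carrier fps_group"
    by (simp add: fps_compose_diffeo)
next
  fix A assume "A \<in> carrier fps_group"
  then show "\<exists>B\<in>carrier fps_group. B \<otimes>\<^bsub>fps_group\<^esub> A = \<one>\<^bsub>fps_group\<^esub>"
    by (intro bexI[of _ "fps_inv A"]) (auto simp: diffeo_fps_def fps_inv fps_inv_nth_1[simplified])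
qed (auto simp: diffeo_fps_def fps_compose_assoc fps_X_fps_compose_startby0)

lemma inv_fps_group: "A \<in> diffeo_fps \<Longrightarrow> inv\<^bsub>fps_group\<^esub> A = fps_inv A"
  by (rule fps_group.inv_equality) (auto simp: diffeo_fps_def fps_inv fps_inv_nth_1[simplified])

section \<open>Conjugation and cyclic rotation in groups\<close>

context group
begin

lemma conj_nat_pow:
  assumes "x \<in> carrier G" "h \<in> carrier G"
  shows "(inv h \<otimes> x \<otimes> h) [^] (n::nat) = inv h \<otimes> x [^] n \<otimes> h"
proof (induction n)
  case (Suc n)
  have "(inv h \<otimes> x \<otimes> h) [^] Suc n = (inv h \<otimes> x [^] n) \<otimes> (h \<otimes> (inv h \<otimes> (x \<otimes> h)))"
    using assms Suc by (simp add: m_assoc)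
  also have "h \<otimes> (inv h \<otimes> (x \<otimes> h)) = x \<otimes> h"
    using assms by (simp flip: m_assoc)
  finally show ?case using assms by (simp add: m_assoc)
qed (use assms in simp)

text \<open>In a group a one-sided inverse is two-sided, so moving the first block to the end
  preserves triviality even when it changes the value.\<close>

lemma block_val_rotate:
  assumes "a \<in> carrier G" "b \<in> carrier G"
  shows "block_val a b (c # u) = \<one> \<longleftrightarrow> block_val a b (u @ [c]) = \<one>"
  using assms by (auto simp: block_val_append intro: inv_comm)

lemma block_val_merge:
  assumes "a \<in> carrier G" "b \<in> carrier G"
  shows "block_val a b (u @ [(x, m), (x, n)]) = block_val a b u \<otimes> gen_val a b x [^] (m + n)"
  using assms by (simp add: block_val_append nat_pow_mult)

end

text \<open>Since \<open>(h^-1 g h)^n = h^-1 g^n h\<close>, evaluation in the group agrees with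
  \<open>fps_word\<close>; this links the group-theoretic reductions to the derivative
  computation.\<close>

lemma block_val_fps_group:
  assumes "F \<in> diffeo_fps" "G \<in> diffeo_fps" "H \<in> diffeo_fps"
  shows "fps_group.block_val F (inv\<^bsub>fps_group\<^esub> H \<otimes>\<^bsub>fps_group\<^esub> G \<otimes>\<^bsub>fps_group\<^esub> H) w =
         fps_word (\<lambda>n. F [^]\<^bsub>fps_group\<^esub> n) (\<lambda>n. G [^]\<^bsub>fps_group\<^esub> n) H w"
proof (induction w)
  case (Cons c w)
  have pow: "G [^]\<^bsub>fps_group\<^esub> n \<in> diffeo_fps" for n :: nat
    using fps_group.nat_pow_closed assms by simp
  have "fps_group.block_val F (inv\<^bsub>fps_group\<^esub> H \<otimes>\<^bsub>fps_group\<^esub> G \<otimes>\<^bsub>fps_group\<^esub> H) w \<in> carrier fps_group"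
    by (intro fps_group.block_val_closed fps_group.m_closed fps_group.inv_closed) (use assms in auto)
  moreover obtain x n where c: "c = (x, n)" by (cases c)
  ultimately show ?case
  proof (cases x)
    case GA
    then show ?thesis using Cons by (simp add: c gen_val_def)
  next
    case GB
    let ?v = "fps_group.block_val F (inv\<^bsub>fps_group\<^esub> H \<otimes>\<^bsub>fps_group\<^esub> G \<otimes>\<^bsub>fps_group\<^esub> H) w"
    assume v: "?v \<in> carrier fps_group"
    have "fps_group.block_val F (inv\<^bsub>fps_group\<^esub> H \<otimes>\<^bsub>fps_group\<^esub> G \<otimes>\<^bsub>fps_group\<^esub> H) (c # w) =
        (inv\<^bsub>fps_group\<^esub> H \<otimes>\<^bsub>fps_group\<^esub> G [^]\<^bsub>fps_group\<^esub> n \<otimes>\<^bsub>fps_group\<^esub> H) \<otimes>\<^bsub>fps_group\<^esub> ?v"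
      using assms by (simp only: fps_group.block_val_simps c GB gen_val_def gen.case fst_conv snd_conv
          fps_group.conj_nat_pow fps_group_simps(1))
    also have "\<dots> = inv\<^bsub>fps_group\<^esub> H \<otimes>\<^bsub>fps_group\<^esub> (G [^]\<^bsub>fps_group\<^esub> n \<otimes>\<^bsub>fps_group\<^esub> (H \<otimes>\<^bsub>fps_group\<^esub> ?v))"
      using v assms pow fps_group.inv_closed fps_group.m_closed
      by (simp only: fps_group.m_assoc fps_group_simps(1))
    finally show ?thesis using Cons assms by (simp add: c GB inv_fps_group)
  qed
qed simp

section \<open>Taylor series of representatives of germs\<close>

abbreviation (input) taylor :: "(complex \<Rightarrow> complex) \<Rightarrow> complex fps" where
  "taylor h \<equiv> fps_expansion h 0"

lemma Diff0_has_fps_expansion: "h \<in> Diff0 \<Longrightarrow> h has_fps_expansion taylor h"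
  unfolding Diff0_def by (force intro: has_fps_expansion_fps_expansion)

lemma taylor_diffeo: "h \<in> Diff0 \<Longrightarrow> taylor h \<in> diffeo_fps"
  by (auto simp: Diff0_def diffeo_fps_def fps_expansion_def)

lemma has_fps_expansion_Diff0:
  assumes h: "h has_fps_expansion A" and A: "A \<in> diffeo_fps"
  shows "h \<in> Diff0"
proof -
  obtain s where "open s" "0 \<in> s" "h holomorphic_on s"
    using has_fps_expansion_imp_holomorphic[OF h] by metis
  then have "\<exists>r>0. h holomorphic_on ball 0 r"
    by (meson open_contains_ball holomorphic_on_subset)
  moreover have "h 0 = 0"
    using has_fps_expansion_imp_0_eq_fps_nth_0[OF h] A by (simp add: diffeo_fps_def)
  moreover have "deriv h 0 = A $ 1"
    using fps_expansion_eqI[OF h] by (auto simp: fps_expansion_def)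
  ultimately show ?thesis using A by (simp add: Diff0_def diffeo_fps_def)
qed

lemma germ_eq_iff_taylor:
  assumes "f \<in> Diff0" "g \<in> Diff0"
  shows "germ_eq f g \<longleftrightarrow> taylor f = taylor g"
proof
  assume "germ_eq f g"
  then have "f has_fps_expansion taylor g"
    using has_fps_expansion_cong[of f g] Diff0_has_fps_expansion[OF assms(2)] by (simp add: germ_eq_def)
  then show "taylor f = taylor g" by (rule fps_expansion_eqI)
next
  assume "taylor f = taylor g"
  then have "(\<lambda>z. f z - g z) has_fps_expansion 0"
    using has_fps_expansion_diff[OF assms[THEN Diff0_has_fps_expansion]] by simp
  then show "germ_eq f g" by (simp add: has_fps_expansion_0_iff germ_eq_def)
qed

lemma
  assumes "f \<in> Diff0" "g \<in> Diff0"
  shows Diff0_compose: "f \<circ> g \<in> Diff0"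
    and taylor_compose: "taylor (f \<circ> g) = taylor f oo taylor g"
proof -
  have *: "(f \<circ> g) has_fps_expansion (taylor f oo taylor g)"
    using assms taylor_diffeo[OF assms(2)]
    by (intro has_fps_expansion_compose Diff0_has_fps_expansion) (auto simp: diffeo_fps_def)
  then show "taylor (f \<circ> g) = taylor f oo taylor g" by (rule fps_expansion_eqI)
  show "f \<circ> g \<in> Diff0"
    using * assms by (auto intro!: has_fps_expansion_Diff0 fps_compose_diffeo taylor_diffeo)
qed

lemma id_has_fps_expansion: "(id :: complex \<Rightarrow> complex) has_fps_expansion fps_X"
  unfolding id_def by (rule has_fps_expansion_fps_X)

lemma id_Diff0: "id \<in> Diff0" and taylor_id: "taylor id = fps_X"
  using id_has_fps_expansion by (auto intro: has_fps_expansion_Diff0 fps_expansion_eqI)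

text \<open>Inverse function theorem on a small ball where \<open>h\<close> is injective; the
  identity \<open>deriv h z * deriv h' (h z) = 1\<close> at 0 gives the inverse a nonzero derivative
  there, so it lies in \<open>Diff0\<close>.\<close>

lemma Diff0_left_inverse:
  assumes "h \<in> Diff0"
  obtains h' where "h' \<in> Diff0" "taylor h' oo taylor h = fps_X"
proof -
  from assms obtain r where r: "r > 0" "h holomorphic_on ball 0 r" and h0: "h 0 = 0" "deriv h 0 \<noteq> 0"
    unfolding Diff0_def by blast
  have z: "(0::complex) \<in> ball 0 r" using r by simp
  obtain s where s: "s > 0" "ball (0::complex) s \<subseteq> ball 0 r" "open (h ` ball 0 s)" "inj_on h (ball 0 s)"
    by (rule has_complex_derivative_locally_invertible[OF r(2) z open_ball h0(2)]) (rule that)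
  have hol: "h holomorphic_on ball 0 s" using r s holomorphic_on_subset by blast
  obtain h' where h': "h' holomorphic_on (h ` ball 0 s)"
      "\<And>z. z \<in> ball 0 s \<Longrightarrow> deriv h z * deriv h' (h z) = 1"
      "\<And>z. z \<in> ball 0 s \<Longrightarrow> h' (h z) = z"
    using holomorphic_has_inverse[OF hol open_ball s(4)] by blast
  have z: "(0::complex) \<in> ball 0 s" using s by simp
  then have "0 \<in> h ` ball 0 s" using h0 by force
  then obtain e where "e > 0" "ball 0 e \<subseteq> h ` ball 0 s"
    using s by (meson open_contains_ball)
  then have "h' \<in> Diff0"
    using h'(1) h'(2)[OF z] h'(3)[OF z] h0 by (auto simp: Diff0_def intro: holomorphic_on_subset)
  moreover have "germ_eq (h' \<circ> h) id"
    using h'(3) z unfolding germ_eq_def eventually_nhds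
    by (intro exI[of _ "ball 0 s"]) auto
  ultimately show ?thesis
    using that assms by (metis Diff0_compose germ_eq_iff_taylor id_Diff0 taylor_compose taylor_id)
qed

section \<open>The group of germs and its embedding into formal series\<close>

lemma germ_class_eq_iff:
  "f \<in> Diff0 \<Longrightarrow> g \<in> Diff0 \<Longrightarrow> germ_class f = germ_class g \<longleftrightarrow> taylor f = taylor g"
proof
  assume fg: "f \<in> Diff0" "g \<in> Diff0" and eq: "germ_class f = germ_class g"
  then have "g \<in> germ_class g" by (simp add: germ_class_def germ_eq_iff_taylor)
  then have "g \<in> germ_class f" by (simp only: eq)
  then show "taylor f = taylor g" using fg by (simp add: germ_class_def germ_eq_iff_taylor)
qed (auto simp: germ_class_def germ_eq_iff_taylor)

lemma
  assumes "f \<in> Diff0"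
  shows germ_rep_Diff0: "germ_rep (germ_class f) \<in> Diff0"
    and taylor_germ_rep: "taylor (germ_rep (germ_class f)) = taylor f"
proof -
  have "f \<in> germ_class f" using assms by (simp add: germ_class_def germ_eq_iff_taylor)
  then have "germ_rep (germ_class f) \<in> germ_class f"
    unfolding germ_rep_def by (rule someI[of "\<lambda>g. g \<in> germ_class f"])
  then show "germ_rep (germ_class f) \<in> Diff0" "taylor (germ_rep (germ_class f)) = taylor f"
    using assms by (auto simp: germ_class_def germ_eq_iff_taylor)
qed

lemma Diff_group_simps:
  "carrier Diff_group = germ_class ` Diff0"
  "\<one>\<^bsub>Diff_group\<^esub> = germ_class id"
  by (simp_all add: Diff_group_def)

lemma Diff_group_mult:
  assumes "f \<in> Diff0" "g \<in> Diff0"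
  shows "germ_class f \<otimes>\<^bsub>Diff_group\<^esub> germ_class g = germ_class (f \<circ> g)"
  using assms
  by (simp add: Diff_group_def germ_class_eq_iff Diff0_compose germ_rep_Diff0 taylor_compose taylor_germ_rep)

interpretation Diff_group: group Diff_group
proof (rule groupI)
  fix x assume "x \<in> carrier Diff_group"
  then obtain h where h: "h \<in> Diff0" "x = germ_class h" by (auto simp: Diff_group_simps)
  obtain h' where "h' \<in> Diff0" "taylor h' oo taylor h = fps_X"
    using Diff0_left_inverse[OF h(1)] .
  then show "\<exists>y\<in>carrier Diff_group. y \<otimes>\<^bsub>Diff_group\<^esub> x = \<one>\<^bsub>Diff_group\<^esub>"
    using h by (auto intro!: bexI[of _ "germ_class h'"]
        simp: Diff_group_simps Diff_group_mult germ_class_eq_iff taylor_compose Diff0_compose id_Diff0 taylor_id)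
qed (auto simp: Diff_group_simps Diff_group_mult Diff0_compose id_Diff0 comp_assoc)

definition class_taylor :: "(complex \<Rightarrow> complex) set \<Rightarrow> complex fps" where
  "class_taylor X = taylor (germ_rep X)"

lemma class_taylor [simp]: "f \<in> Diff0 \<Longrightarrow> class_taylor (germ_class f) = taylor f"
  by (simp add: class_taylor_def taylor_germ_rep)

interpretation class_taylor: group_hom Diff_group fps_group class_taylor
  by unfold_locales
     (auto simp: hom_def Diff_group_simps Diff_group_mult taylor_compose Diff0_compose taylor_diffeo)

text \<open>A germ is determined by its Taylor series. Hence triviality of a word in germs can be
  tested on power series.\<close>

lemma inj_on_class_taylor: "inj_on class_taylor (carrier Diff_group)"
  by (auto simp: inj_on_def Diff_group_simps germ_class_eq_iff)

lemma class_taylor_block_val: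
  assumes "a \<in> carrier Diff_group" "b \<in> carrier Diff_group"
  shows "class_taylor (Diff_group.block_val a b w) =
         fps_group.block_val (class_taylor a) (class_taylor b) w"
proof (induction w)
  case (Cons c w)
  have "class_taylor (gen_val a b x) = gen_val (class_taylor a) (class_taylor b) x" for x
    by (cases x) (simp_all add: gen_val_def)
  then show ?case
    using Cons assms class_taylor.hom_mult class_taylor.hom_nat_pow
    by (simp del: fps_group_simps)
qed (simp only: Diff_group.block_val_simps fps_group.block_val_simps class_taylor.hom_one)

lemma Diff0_funpow: "f \<in> Diff0 \<Longrightarrow> f ^^ n \<in> Diff0"
  by (induction n) (auto intro: id_Diff0 Diff0_compose)

lemma taylor_funpow: "f \<in> Diff0 \<Longrightarrow> taylor (f ^^ n) = taylor f [^]\<^bsub>fps_group\<^esub> n"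
proof (induction n)
  case (Suc n)
  then show ?case
    by (simp only: funpow.simps taylor_compose Diff0_funpow)
       (metis Suc fps_group.nat_pow_Suc2 fps_group_simps(1,2) taylor_diffeo)
qed (simp add: taylor_id)

lemma has_period_taylor:
  assumes "f \<in> Diff0" "has_period f k"
  shows "taylor f [^]\<^bsub>fps_group\<^esub> k = fps_X"
    and "0 < j \<Longrightarrow> j < k \<Longrightarrow> taylor f [^]\<^bsub>fps_group\<^esub> j \<noteq> fps_X"
proof -
  have "germ_eq (f ^^ j) id \<longleftrightarrow> taylor f [^]\<^bsub>fps_group\<^esub> j = fps_X" for j
    using assms by (simp add: germ_eq_iff_taylor Diff0_funpow id_Diff0 taylor_id taylor_funpow)
  then show "taylor f [^]\<^bsub>fps_group\<^esub> k = fps_X"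
    and "0 < j \<Longrightarrow> j < k \<Longrightarrow> taylor f [^]\<^bsub>fps_group\<^esub> j \<noteq> fps_X"
    using assms by (auto simp: has_period_def)
qed

section \<open>The analytic topology\<close>

text \<open>The extension chosen in \<^const>\<open>germ_norm\<close> is unique by the identity theorem.\<close>

lemma germ_norm_less_iff:
  assumes "r > 0"
  shows "germ_norm r h < ereal \<epsilon> \<longleftrightarrow>
    (\<exists>H c. H holomorphic_on ball 0 r \<and> germ_eq H h \<and> c < \<epsilon> \<and> (\<forall>z\<in>ball 0 r. cmod (H z) \<le> c))"
    (is "?L \<longleftrightarrow> ?R")
proof (cases "\<exists>H. H holomorphic_on ball 0 r \<and> germ_eq H h")
  case True
  define H where "H = (SOME H. H holomorphic_on ball 0 r \<and> germ_eq H h)"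
  have H: "H holomorphic_on ball 0 r" "germ_eq H h"
    using someI_ex[OF True] by (auto simp: H_def)
  have norm: "germ_norm r h = (SUP z\<in>ball 0 r. ereal (cmod (H z)))"
    using True by (simp add: germ_norm_def H_def)
  show ?thesis
  proof
    assume ?L
    \<comment> \<open>This lower bound excludes minus infinity and the assumption excludes plus
      infinity, so the supremum is a real number \<open>c\<close>.\<close>
    have "ereal (cmod (H 0)) \<le> germ_norm r h"
      unfolding norm using \<open>r > 0\<close> by (intro SUP_upper) auto
    with \<open>?L\<close> obtain c where c: "germ_norm r h = ereal c"
      by (cases "germ_norm r h") auto
    have "cmod (H z) \<le> c" if "z \<in> ball 0 r" for z
    proof -
      have "ereal (cmod (H z)) \<le> ereal c"
        unfolding c[symmetric] norm using that by (intro SUP_upper)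
      then show ?thesis by simp
    qed
    with H c \<open>?L\<close> show ?R by (intro exI[of _ H] exI[of _ c]) auto
  next
    assume ?R
    then obtain H' c where H': "H' holomorphic_on ball 0 r" "germ_eq H' h" "c < \<epsilon>"
      "\<And>z. z \<in> ball 0 r \<Longrightarrow> cmod (H' z) \<le> c" by blast
    have "\<forall>\<^sub>F z in nhds 0. H z = H' z"
      using H(2) H'(2) unfolding germ_eq_def by eventually_elim simp
    then obtain S where S: "open S" "0 \<in> S" "\<And>z. z \<in> S \<Longrightarrow> H z = H' z"
      unfolding eventually_nhds by blast
    have "H z = H' z" if "z \<in> ball 0 r" for z
    proof (rule analytic_continuation_open[of "S \<inter> ball 0 r" "ball 0 r" H H' z])
      show "S \<inter> ball 0 r \<noteq> {}" using S(2) \<open>r > 0\<close> by auto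
    qed (use S(1,3) H(1) H'(1) that in auto)
    then have "germ_norm r h \<le> ereal c"
      unfolding norm using H' by (intro SUP_least) auto
    with H'(3) show ?L by (metis less_ereal.simps(1) order_le_less_trans)
  qed
qed (auto simp: germ_norm_def)

definition germ_ball :: "(complex \<Rightarrow> complex) \<Rightarrow> real \<Rightarrow> real \<Rightarrow> (complex \<Rightarrow> complex) set" where
  "germ_ball f r \<epsilon> = {g \<in> Diff0. germ_norm r (\<lambda>z. g z - f z) < ereal \<epsilon>}"

lemma analytic_basis_alt: "analytic_basis = {germ_ball f r \<epsilon> |f r \<epsilon>. f \<in> Diff0 \<and> r > 0 \<and> \<epsilon> > 0}"
  by (simp add: analytic_basis_def germ_ball_def)

lemma mem_germ_ball_iff:
  assumes "r > 0"
  shows "g \<in> germ_ball f r \<epsilon> \<longleftrightarrow> g \<in> Diff0 \<and>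
    (\<exists>H c. H holomorphic_on ball 0 r \<and> (\<forall>\<^sub>F z in nhds 0. H z = g z - f z) \<and> c < \<epsilon> \<and>
           (\<forall>z\<in>ball 0 r. cmod (H z) \<le> c))"
  using germ_norm_less_iff[OF assms, of "\<lambda>z. g z - f z"] by (simp add: germ_ball_def germ_eq_def)

lemma germ_ball_center: "f \<in> Diff0 \<Longrightarrow> r > 0 \<Longrightarrow> \<epsilon> > 0 \<Longrightarrow> f \<in> germ_ball f r \<epsilon>"
  by (auto simp: mem_germ_ball_iff intro!: exI[of _ "\<lambda>_. 0"] exI[of _ 0])

lemma germ_ball_mono:
  assumes "0 < r" "r \<le> r'" "\<epsilon>' \<le> \<epsilon>"
  shows "germ_ball f r' \<epsilon>' \<subseteq> germ_ball f r \<epsilon>"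
proof
  fix g assume "g \<in> germ_ball f r' \<epsilon>'"
  then obtain H c where "g \<in> Diff0" "H holomorphic_on ball 0 r'" "\<forall>\<^sub>F z in nhds 0. H z = g z - f z"
      "c < \<epsilon>'" "\<And>z. z \<in> ball 0 r' \<Longrightarrow> cmod (H z) \<le> c"
    using assms mem_germ_ball_iff[of r' g f \<epsilon>'] by auto
  moreover have "ball (0::complex) r \<subseteq> ball 0 r'" using assms by (simp add: subset_ball)
  ultimately show "g \<in> germ_ball f r \<epsilon>"
    using assms unfolding mem_germ_ball_iff[OF \<open>0 < r\<close>]
    by (intro conjI exI[of _ H] exI[of _ c]) (auto intro: holomorphic_on_subset)
qed

text \<open>The bound \<open>c\<close> for \<open>h - f\<close> is strictly below
  \<open>\<epsilon>\<close>, so by the triangle inequality the slack \<open>\<epsilon> - c\<close>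
  is available for \<open>g - h\<close>.\<close>

lemma germ_ball_contains_centered:
  assumes "0 < r" "h \<in> germ_ball f r \<epsilon>"
  shows "\<exists>\<delta>>0. germ_ball h r \<delta> \<subseteq> germ_ball f r \<epsilon>"
proof -
  obtain H c where H: "H holomorphic_on ball 0 r" "\<forall>\<^sub>F z in nhds 0. H z = h z - f z"
      "c < \<epsilon>" "\<And>z. z \<in> ball 0 r \<Longrightarrow> cmod (H z) \<le> c"
    using assms by (auto simp: mem_germ_ball_iff)
  have "germ_ball h r (\<epsilon> - c) \<subseteq> germ_ball f r \<epsilon>"
  proof
    fix g assume "g \<in> germ_ball h r (\<epsilon> - c)"
    then obtain H' c' where H': "g \<in> Diff0" "H' holomorphic_on ball 0 r" "\<forall>\<^sub>F z in nhds 0. H' z = g z - h z"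
        "c' < \<epsilon> - c" "\<And>z. z \<in> ball 0 r \<Longrightarrow> cmod (H' z) \<le> c'"
      using assms by (auto simp: mem_germ_ball_iff)
    have "\<forall>\<^sub>F z in nhds 0. H' z + H z = g z - f z"
      using H(2) H'(3) by eventually_elim simp
    moreover have "cmod (H' z + H z) \<le> c' + c" if "z \<in> ball 0 r" for z
      using H(4)[OF that] H'(5)[OF that] norm_triangle_ineq[of "H' z" "H z"] by linarith
    ultimately show "g \<in> germ_ball f r \<epsilon>"
      using H H' assms unfolding mem_germ_ball_iff[OF \<open>0 < r\<close>]
      by (intro conjI exI[of _ "\<lambda>z. H' z + H z"] exI[of _ "c' + c"]) (auto intro: holomorphic_on_add)
  qed
  with H(3) show ?thesis by (intro exI[of _ "\<epsilon> - c"]) auto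
qed

lemma openin_germ_ball: "f \<in> Diff0 \<Longrightarrow> r > 0 \<Longrightarrow> \<epsilon> > 0 \<Longrightarrow> openin analytic_topology (germ_ball f r \<epsilon>)"
  unfolding analytic_topology_def
  by (intro topology_generated_by_Basis) (auto simp: analytic_basis_alt)

lemma topspace_analytic_topology [simp]: "topspace analytic_topology = Diff0"
proof -
  have "germ_ball f r \<epsilon> \<subseteq> Diff0" for f r \<epsilon> by (auto simp: germ_ball_def)
  moreover have "f \<in> \<Union>analytic_basis" if "f \<in> Diff0" for f
    using germ_ball_center[OF that, of 1 1] that unfolding analytic_basis_alt
    by (intro UnionI[of "germ_ball f 1 1"]) (auto intro!: exI[of _ f] exI[of _ "1::real"])
  ultimately show ?thesis
    by (auto simp: analytic_topology_def analytic_basis_alt)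
qed

text \<open>Induction over the topology generated by \<open>analytic_basis\<close>. A larger radius
  and a smaller tolerance both shrink a ball about \<open>h\<close>, which settles intersections;
  basic sets are recentred at \<open>h\<close>.\<close>

lemma openin_contains_germ_ball:
  assumes "openin analytic_topology V" "h \<in> V"
  shows "\<exists>r>0. \<exists>\<epsilon>>0. germ_ball h r \<epsilon> \<subseteq> V"
proof -
  have "generate_topology_on analytic_basis V"
    using assms(1) unfolding analytic_topology_def by (rule openin_topology_generated_by)
  then show ?thesis using assms(2)
  proof induction
    case (Int a b)
    then obtain r \<epsilon> s \<delta> where "r > 0" "\<epsilon> > 0" "s > 0" "\<delta> > 0" "germ_ball h r \<epsilon> \<subseteq> a" "germ_ball h s \<delta> \<subseteq> b"
      by blast
    then show ?case
      using germ_ball_mono[of r "max r s" "min \<epsilon> \<delta>" \<epsilon> h] germ_ball_mono[of s "max r s" "min \<epsilon> \<delta>" \<delta> h]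
      by (intro exI[of _ "max r s"] exI[of _ "min \<epsilon> \<delta>"] conjI) auto
  next
    case (UN K)
    then obtain k where "k \<in> K" "h \<in> k" by blast
    with UN.IH obtain r \<epsilon> where "r > 0" "\<epsilon> > 0" "germ_ball h r \<epsilon> \<subseteq> k" by blast
    with \<open>k \<in> K\<close> show ?case by (intro exI[of _ r] exI[of _ \<epsilon>]) auto
  next
    case (Basis s)
    then obtain f r \<epsilon> where "r > 0" "s = germ_ball f r \<epsilon>"
      unfolding analytic_basis_alt by blast
    with Basis germ_ball_contains_centered[of r h f \<epsilon>] show ?case by blast
  qed simp
qed

text \<open>Cauchy's inequality for the extension of \<open>g - f\<close> on the circle of radius
  1/2, whose closed disc lies inside the unit ball; this radius is the source of
  \<open>2 ^ n\<close>.\<close>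

lemma germ_ball_taylor:
  assumes "f \<in> Diff0" "g \<in> germ_ball f 1 \<epsilon>"
  shows "cmod (taylor g $ n - taylor f $ n) \<le> \<epsilon> * 2 ^ n"
proof -
  obtain H c where H: "g \<in> Diff0" "H holomorphic_on ball 0 1" "\<forall>\<^sub>F z in nhds 0. H z = g z - f z"
      "c < \<epsilon>" "\<And>z. z \<in> ball 0 1 \<Longrightarrow> cmod (H z) \<le> c"
    using assms mem_germ_ball_iff[of 1 g f \<epsilon>] by auto
  have "(\<lambda>z. g z - f z) has_fps_expansion (taylor g - taylor f)"
    by (intro has_fps_expansion_diff Diff0_has_fps_expansion assms H)
  then have "H has_fps_expansion (taylor g - taylor f)"
    using has_fps_expansion_cong[OF H(3)] by simp
  then have "taylor g $ n - taylor f $ n = (deriv ^^ n) H 0 / fact n"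
    using fps_nth_fps_expansion[of H "taylor g - taylor f" n] by simp
  then have "cmod (taylor g $ n - taylor f $ n) = cmod ((deriv ^^ n) H 0) / fact n"
    by (simp add: norm_divide)
  moreover have "cmod ((deriv ^^ n) H 0) \<le> fact n * c / (1 / 2) ^ n"
  proof (rule Cauchy_inequality)
    have *: "cball (0::complex) (1/2) \<subseteq> ball 0 1" by auto
    show "H holomorphic_on ball 0 (1/2)" "continuous_on (cball 0 (1/2)) H"
      using H(2) * by (auto intro: holomorphic_on_subset holomorphic_on_imp_continuous_on)
  qed (use H(5) in auto)
  then have "cmod ((deriv ^^ n) H 0) / fact n \<le> c * 2 ^ n"
    by (simp add: field_simps power_divide)
  ultimately have "cmod (taylor g $ n - taylor f $ n) \<le> c * 2 ^ n"
    by simp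
  also have "\<dots> \<le> \<epsilon> * 2 ^ n" using H(4) by simp
  finally show ?thesis .
qed

section \<open>Continuity of Taylor coefficients in the analytic topology\<close>

interpretation analytic: coeff_regular
  "\<lambda>\<phi>. \<forall>h\<in>Diff0. (\<phi> \<longlongrightarrow> (\<phi> h :: complex)) (atin analytic_topology h)" Diff0
  by unfold_locales (auto intro: tendsto_add tendsto_mult tendsto_inverse)

lemma regular_taylor: "analytic.regular taylor"
  unfolding analytic.regular_def
proof (intro allI ballI tendstoI)
  fix n and h :: "complex \<Rightarrow> complex" and e :: real
  assume h: "h \<in> Diff0" "e > 0"
  \<comment> \<open>With this tolerance \<open>germ_ball_taylor\<close> bounds the difference of the
    \<open>n\<close>-th coefficients by \<open>e / 2\<close>, strictly below
    \<open>e\<close>.\<close>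
  let ?U = "germ_ball h 1 (e / 2 ^ Suc n)"
  have "dist (taylor g $ n) (taylor h $ n) < e" if "g \<in> ?U" for g
    using germ_ball_taylor[OF h(1) that, of n] h(2) by (simp add: dist_norm)
  then show "\<forall>\<^sub>F g in atin analytic_topology h. dist (taylor g $ n) (taylor h $ n) < e"
    unfolding eventually_atin using h
    by (intro disjI2 exI[of _ ?U]) (auto intro: openin_germ_ball germ_ball_center)
qed

text \<open>Distinct series differ in some single coefficient, and by continuity of that coefficient
  the difference persists nearby.\<close>

lemma openin_fps_neq:
  assumes "analytic.regular W"
  shows "openin analytic_topology {h \<in> Diff0. W h \<noteq> A}"
proof (subst openin_subopen, intro ballI)
  fix h assume "h \<in> {h \<in> Diff0. W h \<noteq> A}"
  then have h: "h \<in> Diff0" and "W h \<noteq> A" by auto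
  then obtain n where n: "W h $ n \<noteq> A $ n" by (auto simp: fps_eq_iff)
  have "((\<lambda>h. W h $ n) \<longlongrightarrow> W h $ n) (atin analytic_topology h)"
    using assms h by (simp add: analytic.regular_def)
  then have "\<forall>\<^sub>F g in atin analytic_topology h. W g $ n \<noteq> A $ n"
    using n by (rule tendsto_imp_eventually_ne)
  then obtain U where U: "openin analytic_topology U" "h \<in> U" "\<And>g. g \<in> U - {h} \<Longrightarrow> W g $ n \<noteq> A $ n"
    using h unfolding eventually_atin by auto
  have "U \<subseteq> {h \<in> Diff0. W h \<noteq> A}"
  proof
    fix g assume "g \<in> U"
    then have "W g $ n \<noteq> A $ n" using U(3) n by (cases "g = h") auto
    then show "g \<in> {h \<in> Diff0. W h \<noteq> A}"
      using openin_subset[OF U(1)] \<open>g \<in> U\<close> by auto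
  qed
  then show "\<exists>T. openin analytic_topology T \<and> h \<in> T \<and> T \<subseteq> {h \<in> Diff0. W h \<noteq> A}"
    using U by blast
qed

section \<open>Perturbation of a germ by monomials\<close>

lemma
  assumes h: "h \<in> Diff0" and "n \<ge> 2"
  shows perturb_Diff0: "(\<lambda>z. h z + t * z ^ n) \<in> Diff0"
    and taylor_perturb: "taylor (\<lambda>z. h z + t * z ^ n) = taylor h + fps_const t * fps_X ^ n"
proof -
  have *: "(\<lambda>z. h z + t * z ^ n) has_fps_expansion (taylor h + fps_const t * fps_X ^ n)"
    by (intro fps_expansion_intros Diff0_has_fps_expansion h)
  then show "taylor (\<lambda>z. h z + t * z ^ n) = taylor h + fps_const t * fps_X ^ n"
    by (rule fps_expansion_eqI)
  show "(\<lambda>z. h z + t * z ^ n) \<in> Diff0"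
    by (rule has_fps_expansion_Diff0[OF *])
       (use taylor_diffeo[OF h] \<open>n \<ge> 2\<close> in \<open>simp add: diffeo_fps_def\<close>)
qed

text \<open>The difference \<open>t * z ^ n\<close> is entire, hence extends to
  \<open>ball 0 r\<close> for every \<open>r\<close> however small the domain of \<open>h\<close>
  is, and there it is bounded by \<open>cmod t * r ^ n\<close>.\<close>

lemma perturb_in_germ_ball:
  assumes "h \<in> Diff0" "n \<ge> 2" "r > 0" "cmod t * r ^ n < \<epsilon>"
  shows "(\<lambda>z. h z + t * z ^ n) \<in> germ_ball h r \<epsilon>"
  unfolding mem_germ_ball_iff[OF \<open>r > 0\<close>]
proof (intro conjI exI[of _ "\<lambda>z. t * z ^ n"] exI[of _ "cmod t * r ^ n"] ballI)
  fix z :: complex assume "z \<in> ball 0 r"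
  then show "cmod (t * z ^ n) \<le> cmod t * r ^ n"
    by (auto simp: norm_mult norm_power intro!: mult_left_mono power_mono)
qed (use assms in \<open>auto intro!: perturb_Diff0 holomorphic_intros\<close>)

section \<open>Generic nontriviality of words\<close>

context group
begin

text \<open>Rotating \<open>x^m u x^n\<close> gives \<open>u x^(n+m)\<close>: the end blocks merge
  and the length drops. Neighbouring blocks differ, so \<open>u\<close> is nonempty and does not end
  in \<open>x\<close>; the result is a nonempty normal form chosen independently of \<open>a\<close>
  and \<open>b\<close>.\<close>

lemma block_val_merge_last:
  assumes w: "normal_form k l ((x, m) # u @ [(x, n)])"
  obtains v where "normal_form k l v" "v \<noteq> []" "length v < length ((x, m) # u @ [(x, n)])"
    "\<And>a b. a \<in> carrier G \<Longrightarrow> b \<in> carrier G \<Longrightarrow> gen_val a b x [^] period_of k l x = \<one> \<Longrightarrow>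
       block_val a b ((x, m) # u @ [(x, n)]) = \<one> \<longleftrightarrow> block_val a b v = \<one>"
proof -
  let ?p = "period_of k l x"
  have u: "normal_form k l u" "u \<noteq> []" "fst (last u) \<noteq> x" and mn: "0 < m" "m < ?p" "0 < n" "n < ?p"
    using w by (auto simp: normal_form_Cons normal_form_append)
  have val: "block_val a b ((x, m) # u @ [(x, n)]) = \<one> \<longleftrightarrow>
               block_val a b u \<otimes> gen_val a b x [^] (n + m) = \<one>"
    if "a \<in> carrier G" "b \<in> carrier G" for a b
    using block_val_rotate[OF that, of "(x, m)" "u @ [(x, n)]"] block_val_merge[OF that, of u x n m]
    by simp
  have append: "normal_form k l (u @ [(x, i)]) \<longleftrightarrow> 0 < i \<and> i < ?p" for i
    using u by (auto simp: normal_form_append normal_form_Cons)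
  have last: "block_val a b (u @ [(x, i)]) = block_val a b u \<otimes> gen_val a b x [^] i"
    if "a \<in> carrier G" "b \<in> carrier G" for a b i
    using that by (simp add: block_val_append)
  \<comment> \<open>Both exponents lie strictly between 0 and the period, so the merged block is
    kept, vanishes, or is reduced by one period.\<close>
  consider "n + m < ?p" | "n + m = ?p" | "?p < n + m" by linarith
  then show ?thesis
  proof cases
    case 1
    show ?thesis
      by (rule that[of "u @ [(x, n + m)]"]) (use 1 mn append val last in auto)
  next
    case 2
    show ?thesis
      by (rule that[of u]) (use 2 u val in auto)
  next
    case 3
    have "gen_val a b x [^] (n + m) = gen_val a b x [^] (n + m - ?p)"
      if "a \<in> carrier G" "b \<in> carrier G" "gen_val a b x [^] ?p = \<one>" for a b
      using 3 nat_pow_mult[of "gen_val a b x" ?p "n + m - ?p"] that by simp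
    note reduce = this
    show ?thesis
    proof (rule that[of "u @ [(x, n + m - ?p)]"])
      fix a b assume ab: "a \<in> carrier G" "b \<in> carrier G" "gen_val a b x [^] ?p = \<one>"
      show "block_val a b ((x, m) # u @ [(x, n)]) = \<one> \<longleftrightarrow> block_val a b (u @ [(x, n + m - ?p)]) = \<one>"
        unfolding val[OF ab(1,2)] last[OF ab(1,2)] reduce[OF ab] ..
    qed (use 3 mn append in auto)
  qed
qed

end

section \<open>Words evaluated at a pair of series of finite order\<close>

locale finite_order_pair =
  fixes F G :: "complex fps" and k l :: nat
  assumes F_diffeo: "F \<in> diffeo_fps" and G_diffeo: "G \<in> diffeo_fps"
    and F_period: "F [^]\<^bsub>fps_group\<^esub> k = fps_X"
    and G_period: "G [^]\<^bsub>fps_group\<^esub> l = fps_X"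
    and F_order: "\<And>j. 0 < j \<Longrightarrow> j < k \<Longrightarrow> F [^]\<^bsub>fps_group\<^esub> j \<noteq> fps_X"
    and G_order: "\<And>j. 0 < j \<Longrightarrow> j < l \<Longrightarrow> G [^]\<^bsub>fps_group\<^esub> j \<noteq> fps_X"
begin

definition conjugate :: "complex fps \<Rightarrow> complex fps" where
  "conjugate H = inv\<^bsub>fps_group\<^esub> H \<otimes>\<^bsub>fps_group\<^esub> G \<otimes>\<^bsub>fps_group\<^esub> H"

definition val :: "(complex \<Rightarrow> complex) \<Rightarrow> (gen \<times> nat) list \<Rightarrow> complex fps" where
  "val h w = fps_group.block_val F (conjugate (taylor h)) w"

sublocale block_series "\<lambda>n. F [^]\<^bsub>fps_group\<^esub> n" "\<lambda>n. G [^]\<^bsub>fps_group\<^esub> n"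
  using fps_group.nat_pow_closed F_diffeo G_diffeo by unfold_locales simp_all

lemma F_carrier: "F \<in> carrier fps_group"
  using F_diffeo by simp

lemma conjugate_carrier: "H \<in> diffeo_fps \<Longrightarrow> conjugate H \<in> carrier fps_group"
  unfolding conjugate_def
  by (intro fps_group.m_closed fps_group.inv_closed) (use G_diffeo in auto)

lemma val_eq_fps_word:
  "h \<in> Diff0 \<Longrightarrow> val h w =
     fps_word (\<lambda>n. F [^]\<^bsub>fps_group\<^esub> n) (\<lambda>n. G [^]\<^bsub>fps_group\<^esub> n) (taylor h) w"
  unfolding val_def conjugate_def using F_diffeo G_diffeo taylor_diffeo by (rule block_val_fps_group)

lemma gen_val_period:
  assumes "H \<in> diffeo_fps"
  shows "gen_val F (conjugate H) x [^]\<^bsub>fps_group\<^esub> period_of k l x = \<one>\<^bsub>fps_group\<^esub>"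
proof (cases x)
  case GB
  have "conjugate H [^]\<^bsub>fps_group\<^esub> l = inv\<^bsub>fps_group\<^esub> H \<otimes>\<^bsub>fps_group\<^esub> \<one>\<^bsub>fps_group\<^esub> \<otimes>\<^bsub>fps_group\<^esub> H"
    unfolding conjugate_def using G_period G_diffeo assms by (subst fps_group.conj_nat_pow) auto
  also have "\<dots> = \<one>\<^bsub>fps_group\<^esub>"
    using assms fps_group.inv_closed[of H] fps_group.r_one fps_group.l_inv[of H]
    by (simp only: fps_group_simps(1))
  finally show ?thesis by (simp add: GB gen_val_def period_of_def)
qed (simp add: gen_val_def period_of_def F_period)

lemma openin_val_neq: "openin analytic_topology {h \<in> Diff0. val h w \<noteq> fps_X}"
proof -
  have "analytic.regular (\<lambda>h. fps_word (\<lambda>n. F [^]\<^bsub>fps_group\<^esub> n) (\<lambda>n. G [^]\<^bsub>fps_group\<^esub> n) (taylor h) w)"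
    using regular_taylor taylor_diffeo
    by (intro analytic.regular_fps_word) (auto simp: diffeo_fps_def)
  from openin_fps_neq[OF this, of fps_X] show ?thesis
    by (simp add: val_eq_fps_word cong: conj_cong)
qed

text \<open>Density of the open set in \<open>openin_val_neq\<close>, phrased as meeting every
  nonempty open set.\<close>

definition generically_nontrivial :: "(gen \<times> nat) list \<Rightarrow> bool" where
  "generically_nontrivial w \<longleftrightarrow>
     (\<forall>V. openin analytic_topology V \<longrightarrow> V \<noteq> {} \<longrightarrow> (\<exists>h\<in>V. val h w \<noteq> fps_X))"

lemma generically_nontrivial_cong:
  assumes "\<And>h. h \<in> Diff0 \<Longrightarrow> val h w = fps_X \<longleftrightarrow> val h v = fps_X" "generically_nontrivial v"
  shows "generically_nontrivial w"
  unfolding generically_nontrivial_def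
proof (intro allI impI)
  fix V assume V: "openin analytic_topology V" "V \<noteq> {}"
  then obtain h where "h \<in> V" "val h v \<noteq> fps_X"
    using assms(2) unfolding generically_nontrivial_def by blast
  moreover have "h \<in> Diff0" using openin_subset[OF V(1)] \<open>h \<in> V\<close> by auto
  ultimately show "\<exists>h\<in>V. val h w \<noteq> fps_X" using assms(1) by blast
qed

text \<open>A finite intersection of open dense sets is dense: \<open>V\<close> is cut down by one
  such set at a time and stays open and nonempty.\<close>

lemma simultaneously_nontrivial:
  assumes "finite W" "\<And>w. w \<in> W \<Longrightarrow> generically_nontrivial w"
    and "openin analytic_topology V" "V \<noteq> {}"
  shows "\<exists>h\<in>V. \<forall>w\<in>W. val h w \<noteq> fps_X"
  using assms
proof (induction arbitrary: V)
  case (insert w W)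
  have sub: "V \<subseteq> Diff0" using openin_subset[OF insert.prems(2)] by simp
  obtain h where "h \<in> V" "val h w \<noteq> fps_X"
    using insert.prems unfolding generically_nontrivial_def by blast
  define V' where "V' = V \<inter> {h \<in> Diff0. val h w \<noteq> fps_X}"
  have "V' \<noteq> {}" using sub \<open>h \<in> V\<close> \<open>val h w \<noteq> fps_X\<close> by (auto simp: V'_def)
  moreover have "openin analytic_topology V'"
    unfolding V'_def by (rule openin_Int[OF insert.prems(2) openin_val_neq])
  ultimately obtain g where "g \<in> V'" "\<forall>w\<in>W. val g w \<noteq> fps_X"
    using insert.IH[of V'] insert.prems(1) by auto
  then show ?case by (auto simp: V'_def)
qed auto

text \<open>Two suffixes differ by left multiplication with the subword between their starting
  positions. Equal values would cancel and make that subword trivial, which \<open>sub\<close>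
  excludes.\<close>

lemma suffix_values_inj:
  assumes h: "h \<in> Diff0"
    and sub: "\<And>i j. i < j \<Longrightarrow> j \<le> length w \<Longrightarrow> val h (take (j - i) (drop i w)) \<noteq> fps_X"
  shows "inj_on (\<lambda>i. val h (drop i w)) {..length w}"
proof -
  let ?b = "conjugate (taylor h)"
  note b = conjugate_carrier[OF taylor_diffeo[OF h]]
  have "val h (drop i w) \<noteq> val h (drop j w)" if "i < j" "j \<le> length w" for i j
  proof
    assume eq: "val h (drop i w) = val h (drop j w)"
    have "drop i w = take (j - i) (drop i w) @ drop j w"
      using that by (metis append_take_drop_id drop_drop le_add_diff_inverse2 less_imp_le)
    then have "val h (drop i w) = val h (take (j - i) (drop i w)) \<otimes>\<^bsub>fps_group\<^esub> val h (drop j w)"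
      unfolding val_def by (subst fps_group.block_val_append[OF F_carrier b, symmetric]) simp
    then have "val h (take (j - i) (drop i w)) \<otimes>\<^bsub>fps_group\<^esub> val h (drop j w) = val h (drop j w)"
      by (simp only: eq)
    then have "val h (take (j - i) (drop i w)) = \<one>\<^bsub>fps_group\<^esub>"
      unfolding val_def
      by (rule fps_group.r_cancel_one[THEN iffD1, rotated 2])
         (rule fps_group.block_val_closed[OF F_carrier b])+
    with sub[OF that] show False by simp
  qed
  then show ?thesis
    by (intro linorder_inj_onI') auto
qed

text \<open>An \<open>h\<close> in \<open>V\<close> is chosen with all nonempty subwords of
  \<open>w\<close> nontrivial, so the suffix values are distinct and \<open>w\<close> varies along
  some monomial perturbation. If \<open>w @ [(GA, n)]\<close> were trivial on \<open>V\<close>, then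
  \<open>w\<close> would equal the inverse of \<open>F^n\<close> throughout \<open>V\<close>, which
  does not involve \<open>h\<close>.\<close>

lemma generically_nontrivial_BA:
  assumes nf: "normal_form k l (w @ [(GA, n)])" and w: "w \<noteq> []" "fst (hd w) = GB"
    and shorter: "\<And>v. normal_form k l v \<Longrightarrow> v \<noteq> [] \<Longrightarrow> length v \<le> length w \<Longrightarrow> generically_nontrivial v"
  shows "generically_nontrivial (w @ [(GA, n)])"
  unfolding generically_nontrivial_def
proof (intro allI impI)
  fix V assume V: "openin analytic_topology V" "V \<noteq> {}"
  have VD: "V \<subseteq> Diff0" using openin_subset[OF V(1)] by simp
  \<comment> \<open>All nonempty contiguous subwords of \<open>w\<close>, including \<open>w\<close>
    itself; each is a normal form at most as long as \<open>w\<close>, so \<open>shorter\<close>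
    applies.\<close>
  define W where "W = (\<Union>j\<le>length w. (\<lambda>i. take (j - i) (drop i w)) ` {..<j})"
  have "finite W" by (simp add: W_def)
  moreover have "generically_nontrivial v" if vW: "v \<in> W" for v
  proof -
    obtain i j where ij: "i < j" "j \<le> length w" and v: "v = take (j - i) (drop i w)"
      using vW by (auto simp: W_def)
    have "normal_form k l w" using nf by (simp add: normal_form_append)
    then have "normal_form k l (take i w @ v @ drop (j - i) (drop i w))"
      unfolding v by (simp only: append_take_drop_id)
    then have "normal_form k l v" by (simp add: normal_form_append)
    then show ?thesis using shorter[of v] ij v by simp
  qed
  ultimately have "\<exists>h\<in>V. \<forall>v\<in>W. val h v \<noteq> fps_X"
    by (rule simultaneously_nontrivial[OF _ _ V])
  then obtain h where "h \<in> V" and h: "\<And>v. v \<in> W \<Longrightarrow> val h v \<noteq> fps_X"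
    by blast
  have hD: "h \<in> Diff0" using VD \<open>h \<in> V\<close> by blast
  have "val h (take (j - i) (drop i w)) \<noteq> fps_X" if "i < j" "j \<le> length w" for i j
    using that by (intro h) (auto simp: W_def)
  then have "inj_on (\<lambda>i. val h (drop i w)) {..length w}"
    by (rule suffix_values_inj[OF hD])
  then obtain m where m: "m \<ge> 2" and nonconst:
      "\<not> (\<forall>\<^sub>F t in nhds 0. fps_word (\<lambda>n. F [^]\<^bsub>fps_group\<^esub> n) (\<lambda>n. G [^]\<^bsub>fps_group\<^esub> n)
            (taylor h + fps_const t * fps_X ^ m) w = val h w)"
    using fps_word_nonconstant[OF taylor_diffeo[OF hD] w] hD by (auto simp: val_eq_fps_word)
  define h' where "h' t = (\<lambda>z. h z + t * z ^ m)" for t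
  have h'D: "h' t \<in> Diff0" for t unfolding h'_def by (rule perturb_Diff0[OF hD m])
  have nonconst': "\<not> (\<forall>\<^sub>F t in nhds 0. val (h' t) w = val h w)"
    using nonconst unfolding val_eq_fps_word[OF h'D]
    unfolding h'_def taylor_perturb[OF hD m] .
  obtain r \<epsilon> where r: "r > 0" "\<epsilon> > 0" "germ_ball h r \<epsilon> \<subseteq> V"
    using openin_contains_germ_ball[OF V(1) \<open>h \<in> V\<close>] by blast
  have "((\<lambda>t. cmod t * r ^ m) \<longlongrightarrow> 0) (nhds 0)"
    by (auto intro!: tendsto_eq_intros filterlim_ident)
  then have "\<forall>\<^sub>F t in nhds 0. cmod t * r ^ m < \<epsilon>"
    using r(2) by (rule order_tendstoD(2))
  then have ev: "\<forall>\<^sub>F t in nhds 0. h' t \<in> V"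
    by (rule eventually_mono) (use perturb_in_germ_ball[OF hD m r(1)] r(3) in \<open>auto simp: h'_def\<close>)
  show "\<exists>h\<in>V. val h (w @ [(GA, n)]) \<noteq> fps_X"
  proof (rule ccontr)
    assume "\<not> ?thesis"
    then have triv: "val g (w @ [(GA, n)]) = fps_X" if "g \<in> V" for g using that by blast
    have "val g w = inv\<^bsub>fps_group\<^esub> (F [^]\<^bsub>fps_group\<^esub> n)" if "g \<in> V" for g
    proof -
      note b = conjugate_carrier[OF taylor_diffeo[OF subsetD[OF VD that]]]
      have "val g w \<otimes>\<^bsub>fps_group\<^esub> F [^]\<^bsub>fps_group\<^esub> n = \<one>\<^bsub>fps_group\<^esub>"
        using triv[OF that] fps_group.block_val_append[OF F_carrier b, of w "[(GA, n)]"]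
          fps_group.nat_pow_closed[OF F_carrier] fps_group.r_one
        by (simp add: val_def gen_val_def)
      then show ?thesis
        using fps_group.inv_equality fps_group.nat_pow_closed[OF F_carrier]
          fps_group.block_val_closed[OF F_carrier b] unfolding val_def by metis
    qed
    then have "\<forall>\<^sub>F t in nhds 0. val (h' t) w = val h w"
      using ev \<open>h \<in> V\<close> by (auto elim: eventually_mono)
    with nonconst' show False by contradiction
  qed
qed

text \<open>Strong induction on the length, split by the first and last generators. A single block
  is nontrivial by exactness of the orders, equal ends merge into a shorter word, a word from
  \<open>GB\<close> to \<open>GA\<close> is \<open>generically_nontrivial_BA\<close>, and a word
  from \<open>GA\<close> to \<open>GB\<close> is rotated into that form.\<close>

lemma generically_nontrivial_normal_form:
  "normal_form k l w \<Longrightarrow> w \<noteq> [] \<Longrightarrow> generically_nontrivial w"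
proof (induction w rule: length_induct)
  case (1 w)
  then have shorter: "\<And>v. normal_form k l v \<Longrightarrow> v \<noteq> [] \<Longrightarrow> length v < length w \<Longrightarrow> generically_nontrivial v"
    by blast
  obtain x m u where w: "w = (x, m) # u" using 1(3) by (metis list.exhaust prod.collapse)
  note carrier = F_carrier conjugate_carrier[OF taylor_diffeo]
  show ?case
  proof (cases u rule: rev_cases)
    case Nil
    have xm: "0 < m" "m < period_of k l x" using 1(2) by (auto simp: w normal_form_Cons)
    have "val h w \<noteq> fps_X" if h: "h \<in> Diff0" for h
    proof
      note b = conjugate_carrier[OF taylor_diffeo[OF h]]
      let ?h = "taylor h"
      have hc: "?h \<in> carrier fps_group" using taylor_diffeo[OF h] by simp
      assume "val h w = fps_X"
      then have *: "gen_val F (conjugate ?h) x [^]\<^bsub>fps_group\<^esub> m = \<one>\<^bsub>fps_group\<^esub>"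
        using fps_group.r_one fps_group.nat_pow_closed fps_group.gen_val_closed[OF F_carrier b]
        by (simp add: val_def w Nil)
      show False
      proof (cases x)
        case GA
        then show False using * F_order xm by (simp add: gen_val_def period_of_def)
      next
        case GB
        \<comment> \<open>Undoing the conjugation: triviality of \<open>h^-1 g^m h\<close> forces
          \<open>g^m\<close> to be trivial, impossible for \<open>m\<close> below the
          period.\<close>
        have Gm: "G [^]\<^bsub>fps_group\<^esub> m \<in> carrier fps_group"
          using G_diffeo by (intro fps_group.nat_pow_closed) simp
        have "inv\<^bsub>fps_group\<^esub> ?h \<otimes>\<^bsub>fps_group\<^esub> G [^]\<^bsub>fps_group\<^esub> m \<otimes>\<^bsub>fps_group\<^esub> ?h = \<one>\<^bsub>fps_group\<^esub>"
          using * hc G_diffeo fps_group.conj_nat_pow[of G ?h m] by (simp add: GB gen_val_def conjugate_def)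
        then have "inv\<^bsub>fps_group\<^esub> ?h \<otimes>\<^bsub>fps_group\<^esub> (G [^]\<^bsub>fps_group\<^esub> m \<otimes>\<^bsub>fps_group\<^esub> ?h) = \<one>\<^bsub>fps_group\<^esub>"
          using hc Gm fps_group.m_assoc fps_group.inv_closed by metis
        then have "?h = G [^]\<^bsub>fps_group\<^esub> m \<otimes>\<^bsub>fps_group\<^esub> ?h"
          using hc Gm fps_group.inv_equality fps_group.inv_inv fps_group.inv_closed fps_group.m_closed
            fps_group.inv_solve_left' fps_group.one_closed fps_group.r_one by metis
        then have "G [^]\<^bsub>fps_group\<^esub> m = \<one>\<^bsub>fps_group\<^esub>"
          using hc Gm fps_group.r_cancel_one by metis
        then show False using G_order xm by (simp add: GB period_of_def)
      qed
    qed
    then show ?thesis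
      using openin_subset unfolding generically_nontrivial_def by fastforce
  next
    case (snoc u' c)
    obtain y n where c: "c = (y, n)" by (cases c)
    have w': "w = (x, m) # u' @ [(y, n)]" by (simp add: w snoc c)
    show ?thesis
    proof (cases "x = y")
      case True
      obtain v where v: "normal_form k l v" "v \<noteq> []" "length v < length w"
        "\<And>a b. a \<in> carrier fps_group \<Longrightarrow> b \<in> carrier fps_group \<Longrightarrow>
           gen_val a b x [^]\<^bsub>fps_group\<^esub> period_of k l x = \<one>\<^bsub>fps_group\<^esub> \<Longrightarrow>
           fps_group.block_val a b w = \<one>\<^bsub>fps_group\<^esub> \<longleftrightarrow> fps_group.block_val a b v = \<one>\<^bsub>fps_group\<^esub>"
        using fps_group.block_val_merge_last[of k l x m u' n] 1(2) unfolding w' True by blast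
      have "val h w = fps_X \<longleftrightarrow> val h v = fps_X" if "h \<in> Diff0" for h
        using v(4)[OF carrier(1) carrier(2)[OF that] gen_val_period[OF taylor_diffeo[OF that]]]
        by (simp add: val_def)
      then show ?thesis using shorter[OF v(1-3)] generically_nontrivial_cong by blast
    next
      case False
      show ?thesis
      proof (cases x)
        case GB
        then have "y = GA" using False by (cases y) auto
        then show ?thesis
          using generically_nontrivial_BA[of "(x, m) # u'" n] 1(2) shorter GB by (simp add: w')
      next
        case GA
        then have y: "y = GB" using False by (cases y) auto
        have nf: "normal_form k l ((u' @ [(y, n)]) @ [(GA, m)])"
          using 1(2) y by (auto simp: w' GA normal_form_Cons normal_form_append)
        \<comment> \<open>The block after \<open>(GA, m)\<close> cannot be a \<open>GA\<close>
          block, so the rotated word starts with \<open>GB\<close>, also when \<open>u'\<close> is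
          empty.\<close>
        have "fst (hd (u' @ [(y, n)])) \<noteq> GA"
          using 1(2) by (auto simp: w' GA normal_form_Cons)
        then have "fst (hd (u' @ [(y, n)])) = GB"
          by (cases "fst (hd (u' @ [(y, n)]))") auto
        then have "generically_nontrivial ((u' @ [(y, n)]) @ [(GA, m)])"
          using shorter by (intro generically_nontrivial_BA[OF nf]) (auto simp: w')
        moreover have "val h w = fps_X \<longleftrightarrow> val h ((u' @ [(y, n)]) @ [(GA, m)]) = fps_X" if "h \<in> Diff0" for h
          using fps_group.block_val_rotate[OF carrier(1) carrier(2)[OF that], of "(GA, m)" "u' @ [(y, n)]"]
          by (simp add: val_def w' GA)
        ultimately show ?thesis using generically_nontrivial_cong by blast
      qed
    qed
  qed
qed

end

section \<open>Intersection over all normal forms and transfer to germs\<close>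

theorem theorem4p2:
  fixes f g :: "complex \<Rightarrow> complex" and k l :: nat
  assumes "f \<in> Diff0" and "g \<in> Diff0"
    and "has_period f k" and "has_period g l"
  shows "\<exists>\<H>. Gdelta_dense analytic_topology \<H> \<and>
           (\<forall>h\<in>\<H>.
              Diff_group\<lparr>carrier := generate Diff_group
                 {germ_class f,
                  inv\<^bsub>Diff_group\<^esub> (germ_class h) \<otimes>\<^bsub>Diff_group\<^esub> germ_class g
                    \<otimes>\<^bsub>Diff_group\<^esub> germ_class h}\<rparr>
              \<cong> presented_group k l)"
proof -
  interpret finite_order_pair "taylor f" "taylor g" k l
    by unfold_locales
       (rule taylor_diffeo[OF assms(1)] taylor_diffeo[OF assms(2)]
          has_period_taylor[OF assms(1,3)] has_period_taylor[OF assms(2,4)] | assumption)+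
  \<comment> \<open>One open dense set for each nonempty normal form; these are finite lists over a
    countable alphabet of blocks, so the family is countable.\<close>
  define \<U> where "\<U> = (\<lambda>w. {h \<in> Diff0. val h w \<noteq> fps_X}) ` {w. normal_form k l w \<and> w \<noteq> []}"
  have "\<forall>U\<in>\<U>. openin analytic_topology U \<and> analytic_topology closure_of U = topspace analytic_topology"
  proof
    fix U assume "U \<in> \<U>"
    then obtain w where w: "normal_form k l w" "w \<noteq> []" and U: "U = {h \<in> Diff0. val h w \<noteq> fps_X}"
      by (auto simp: \<U>_def)
    have "U \<inter> V \<noteq> {}" if V: "openin analytic_topology V" "V \<noteq> {}" for V
    proof -
      obtain h where "h \<in> V" "val h w \<noteq> fps_X"
        using generically_nontrivial_normal_form[OF w] V unfolding generically_nontrivial_def by blast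
      then show ?thesis using openin_subset[OF V(1)] by (auto simp: U)
    qed
    then show "openin analytic_topology U \<and> analytic_topology closure_of U = topspace analytic_topology"
      unfolding dense_intersects_open using openin_val_neq by (simp add: U)
  qed
  moreover have "countable \<U>"
  proof -
    have "(UNIV :: gen set) = {GA, GB}" using gen.exhaust by blast
    then have "countable (UNIV :: gen set)" by (metis countable_empty countable_insert)
    then have "countable (UNIV \<times> UNIV :: (gen \<times> nat) set)"
      by (intro countable_SIGMA) simp_all
    then have "countable (UNIV :: (gen \<times> nat) list set)"
      using countable_lists[of "UNIV :: (gen \<times> nat) set"] by simp
    then show ?thesis
      unfolding \<U>_def by (intro countable_image) (rule countable_subset[OF subset_UNIV])
  qed
  \<comment> \<open>For \<open>k = l = 1\<close> there are no nonempty normal forms; the family is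
    then empty and the intersection is all of \<open>Diff0\<close>.\<close>
  ultimately have "Gdelta_dense analytic_topology (Diff0 \<inter> \<Inter>\<U>)"
    by (auto simp: Gdelta_dense_def)
  moreover have "Diff_group\<lparr>carrier := generate Diff_group
       {germ_class f, inv\<^bsub>Diff_group\<^esub> (germ_class h) \<otimes>\<^bsub>Diff_group\<^esub> germ_class g \<otimes>\<^bsub>Diff_group\<^esub> germ_class h}\<rparr>
     \<cong> presented_group k l" if h: "h \<in> Diff0 \<inter> \<Inter>\<U>" for h
  proof -
    let ?a = "germ_class f"
    let ?b = "inv\<^bsub>Diff_group\<^esub> (germ_class h) \<otimes>\<^bsub>Diff_group\<^esub> germ_class g \<otimes>\<^bsub>Diff_group\<^esub> germ_class h"
    have hD: "h \<in> Diff0" using h by blast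
    have cls: "germ_class h \<in> carrier Diff_group" "germ_class g \<in> carrier Diff_group"
        "?a \<in> carrier Diff_group"
      using hD assms by (auto simp: Diff_group_simps)
    then have b: "?b \<in> carrier Diff_group" by simp
    have ct: "class_taylor ?a = taylor f" "class_taylor ?b = conjugate (taylor h)"
      using cls hD assms class_taylor.hom_mult class_taylor.hom_inv
      by (simp_all add: conjugate_def del: fps_group_simps)
    \<comment> \<open>Injectivity of \<open>class_taylor\<close> carries both the relations and the
      nontriviality of words from series back to germs.\<close>
    have one: "x = \<one>\<^bsub>Diff_group\<^esub> \<longleftrightarrow> class_taylor x = \<one>\<^bsub>fps_group\<^esub>" if "x \<in> carrier Diff_group" for x
      using inj_on_class_taylor that Diff_group.one_closed class_taylor.hom_one by (metis inj_onD)
    have pow: "class_taylor (x [^]\<^bsub>Diff_group\<^esub> n) = class_taylor x [^]\<^bsub>fps_group\<^esub> n"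
      if "x \<in> carrier Diff_group" for x and n :: nat
      using that by (rule class_taylor.hom_nat_pow)
    show ?thesis
    proof (rule Diff_group.generate_iso_presented_group[OF cls(3) b])
      show "0 < k" "0 < l" using assms by (auto simp: has_period_def)
      show "?a [^]\<^bsub>Diff_group\<^esub> k = \<one>\<^bsub>Diff_group\<^esub>"
        using gen_val_period[OF taylor_diffeo[OF hD], of GA] cls
        by (simp only: one pow ct Diff_group.nat_pow_closed gen_val_def period_of_def gen.case)
      show "?b [^]\<^bsub>Diff_group\<^esub> l = \<one>\<^bsub>Diff_group\<^esub>"
        using gen_val_period[OF taylor_diffeo[OF hD], of GB] b
        by (simp only: one pow ct Diff_group.nat_pow_closed gen_val_def period_of_def gen.case)
      fix w assume "normal_form k l w" "w \<noteq> []"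
      then have "val h w \<noteq> fps_X" using h by (auto simp: \<U>_def)
      then have "class_taylor (Diff_group.block_val ?a ?b w) \<noteq> \<one>\<^bsub>fps_group\<^esub>"
        unfolding class_taylor_block_val[OF cls(3) b] ct by (simp add: val_def)
      then show "Diff_group.block_val ?a ?b w \<noteq> \<one>\<^bsub>Diff_group\<^esub>"
        using one Diff_group.block_val_closed[OF cls(3) b] by metis
    qed
  qed
  ultimately show ?thesis by blast
qed

end
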